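(* Let $X,Y_1,Y_2$ be real separable Banach spaces and let $\mu$ be a Gaussian measure on $\mathcal{B}(X)$ with mean element $m_\mu$ and covariance operator $C_\mu:X^*\to X$. Let $G_1:X\to Y_1$ and $G_2:X\to Y_2$ be bounded linear operators. Denote by $m_\mu^{(1)}(y_1)$ and $C_\mu^{(1)}$ the mean element and covariance operator of the disintegrating measure $\mu_{|G_1=y_1}$, and by $m_\mu^{(1\oplus2)}(y_1,y_2)$ and $C_\mu^{(1\oplus2)}$ those of the disintegrating measure $\mu_{|(G_1,G_2)=(y_1,y_2)}$. Let $(y_i^{(2)*})_{i\in I}$ be any $G_2C_\mu^{(1)}G_2^*$-representing sequence ($I$ finite or countably infinite). Then $$m_\mu^{(1\oplus2)}(y_1,y_2)=m_\mu^{(1)}(y_1)+\sum_{i\in I}\left\langle y_2-G_2m_\mu^{(1)}(y_1),\,y_i^{(2)*}\right\rangle C_\mu^{(1)}G_2^*y_i^{(2)*},$$ $$C_\mu^{(1\oplus2)}=C_\mu^{(1)}-\sum_{i\in I}\left\langle C_\mu^{(1)}G_2^*y_i^{(2)*},\,\cdot\,\right\rangle C_\mu^{(1)}G_2^*y_i^{(2)*},$$ where the equalities hold for almost all $(y_1,y_2)\in Y_1\bigoplus Y_2$ with respect to $\mu\circ(G_1,G_2)^{-1}$.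
   Context: For a Banach space $X$, $f\in X$, $g^*\in X^*$, write $\langle f,g^*\rangle=g^*(f)$. The operator $(G_1,G_2):X\to Y_1\bigoplus Y_2$ is $x\mapsto G_1(x)\bigoplus G_2(x)$; $Y_1\bigoplus Y_2$ carries any norm inducing the product topology. Banach spaces carry their Borel $\sigma$-algebras. A Gaussian measure on a separable Banach space is a Borel probability measure all of whose pushforwards by continuous linear functionals are Gaussian (possibly degenerate). Its mean element is the unique $m_\mu\in X$ with $\int_X\langle f,g^*\rangle d\mu(f)=\langle m_\mu,g^*\rangle$ for all $g^*\in X^*$; its covariance operator $C_\mu:X^*\to X$ satisfies $\langle C_\mu g_1^*,g_2^*\rangle=\int_X(\langle f,g_1^*\rangle-\langle m_\mu,g_1^*\rangle)(\langle f,g_2^*\rangle-\langle m_\mu,g_2^*\rangle)\,d\mu(f)$. For a symmetric positive operator $R:Y^*\to Y$, a family $(y_i^* )_{i\in I}$ in $Y^*$ is $R$-representing if $\langle Ry_i^*,y_j^*\rangle=\delta_{ij}$ and $\sum_{i\in I}\langle Ry_i^*,y^*\rangle^2=\langle Ry^*,y^*\rangle$ for all $y^*\in Y^*$. Given a probability measure $\mu$ on $(X,\mathcal{A})$ and a measurable map $G:X\to(Y,\mathcal{C})$, a disintegration of $\mu$ with respect to $G$ is a map $\tilde\mu:\mathcal{A}\times Y\to[0,1]$, written $\mu_{|G=y}(\cdot):=\tilde\mu(\cdot,y)$, such that: (1) each $\tilde\mu(\cdot,y)$ is a probability measure and each $\tilde\mu(A,\cdot)$ is measurable; (2) there is a set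 in $\mathcal{C}$ of full $\mu\circ G^{-1}$-measure such that for all $y$ in it $\{y\}\in\mathcal{C}$ and $\tilde\mu(G^{-1}(\{y\}),y)=1$; (3) $\mu(A)=\int_Y\tilde\mu(A,y)\,d(\mu\circ G^{-1})(y)$ for all $A\in\mathcal{A}$. It may be given only for $y$ in a set of full $\mu\circ G^{-1}$-measure, and is unique up to $\mu\circ G^{-1}$-null sets. For a Gaussian measure and a bounded linear operator $G$ there is a disintegration into Gaussian measures $\mu_{|G=y}$ whose covariance operator does not depend on $y$; these are the disintegrating measures meant here. *)

theory Defs
  imports "HOL-Probability.Probability"
begin

text \<open>Separable Banach spaces are rendered by the sort \<open>{banach, second_countable_topology}\<close>, the
  dual space of \<open>'a\<close> by \<open>'a \<Rightarrow>\<^sub>L real\<close>. The adjoint of \<open>G\<close> maps \<open>g\<close> to \<open>g o\<^sub>L G\<close>.\<close>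

definition gaussian_real :: "real measure \<Rightarrow> bool" where
  "gaussian_real \<nu> \<longleftrightarrow>
     (\<exists>m \<sigma>. \<sigma> > 0 \<and> \<nu> = density lborel (\<lambda>x. ennreal (normal_density m \<sigma> x))) \<or>
     (\<exists>m. \<nu> = return borel m)"

definition gaussian_measure ::
    "'a::{banach, second_countable_topology} measure \<Rightarrow> bool" where
  "gaussian_measure \<mu> \<longleftrightarrow>
     prob_space \<mu> \<and> sets \<mu> = sets borel \<and>
     (\<forall>g :: 'a \<Rightarrow>\<^sub>L real. gaussian_real (distr \<mu> borel (blinfun_apply g)))"

text \<open>The next two definitions are only meaningful if the integrals involved exist, as they do for
  Gaussian measures. The objects they describe are then unique, since the dual separates points.\<close>

definition is_mean_element ::
    "'a::{banach, second_countable_topology} measure \<Rightarrow> 'a \<Rightarrow> bool" where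
  "is_mean_element \<mu> m \<longleftrightarrow>
     (\<forall>g :: 'a \<Rightarrow>\<^sub>L real. (\<integral>f. blinfun_apply g f \<partial>\<mu>) = blinfun_apply g m)"

definition is_covariance_operator ::
    "'a::{banach, second_countable_topology} measure \<Rightarrow> (('a \<Rightarrow>\<^sub>L real) \<Rightarrow>\<^sub>L 'a) \<Rightarrow> bool" where
  "is_covariance_operator \<mu> C \<longleftrightarrow>
     (\<exists>m. is_mean_element \<mu> m \<and>
       (\<forall>g1 g2 :: 'a \<Rightarrow>\<^sub>L real.
          blinfun_apply g2 (blinfun_apply C g1) =
          (\<integral>f. (blinfun_apply g1 f - blinfun_apply g1 m) *
               (blinfun_apply g2 f - blinfun_apply g2 m) \<partial>\<mu>)))"

definition representing ::
    "(('b::real_normed_vector \<Rightarrow>\<^sub>L real) \<Rightarrow> 'b) \<Rightarrow> 'i set \<Rightarrow> ('i \<Rightarrow> 'b \<Rightarrow>\<^sub>L real) \<Rightarrow> bool" where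
  "representing R I ys \<longleftrightarrow>
     (\<forall>i\<in>I. \<forall>j\<in>I. blinfun_apply (ys j) (R (ys i)) = (if i = j then 1 else 0)) \<and>
     (\<forall>y :: 'b \<Rightarrow>\<^sub>L real.
        ((\<lambda>i. (blinfun_apply y (R (ys i)))\<^sup>2) has_sum blinfun_apply y (R y)) I)"

definition disintegration ::
    "'a measure \<Rightarrow> ('a \<Rightarrow> 'b) \<Rightarrow> 'b measure \<Rightarrow> ('b \<Rightarrow> 'a measure) \<Rightarrow> bool" where
  "disintegration M G N K \<longleftrightarrow>
     (\<forall>y\<in>space N. prob_space (K y) \<and> sets (K y) = sets M) \<and>
     (\<forall>A\<in>sets M. (\<lambda>y. measure (K y) A) \<in> borel_measurable N) \<and>
     (\<exists>B\<in>sets N. measure (distr M N G) B = 1 \<and>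
        (\<forall>y\<in>B. {y} \<in> sets N \<and> measure (K y) (G -` {y} \<inter> space M) = 1)) \<and>
     (\<forall>A\<in>sets M. measure M A = (\<integral>y. measure (K y) A \<partial>(distr M N G)))"

text \<open>A disintegration into Gaussian measures \<open>K y\<close> with mean element \<open>m y\<close> and a covariance
  operator \<open>C\<close> not depending on \<open>y\<close>. As a disintegration is only determined up to null sets, these
  properties are required almost everywhere.\<close>

definition gaussian_disintegration ::
    "'a::{banach, second_countable_topology} measure \<Rightarrow>
     ('a \<Rightarrow> 'b::{banach, second_countable_topology}) \<Rightarrow>
     ('b \<Rightarrow> 'a measure) \<Rightarrow> ('b \<Rightarrow> 'a) \<Rightarrow> (('a \<Rightarrow>\<^sub>L real) \<Rightarrow>\<^sub>L 'a) \<Rightarrow> bool" where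
  "gaussian_disintegration \<mu> G K m C \<longleftrightarrow>
     disintegration \<mu> G borel K \<and>
     (AE y in distr \<mu> borel G.
        gaussian_measure (K y) \<and> is_mean_element (K y) (m y) \<and> is_covariance_operator (K y) C)"

lift_definition rank_one :: "'a::real_normed_vector \<Rightarrow> (('a \<Rightarrow>\<^sub>L real) \<Rightarrow>\<^sub>L 'a)"
  is "\<lambda>x g. blinfun_apply g x *\<^sub>R x"
  by (intro bounded_linear_intros)

end

theory Submission
  imports Defs "HOL-Real_Asymp.Real_Asymp"
begin

text \<open>Write \<open>Y1 = G1 f\<close> and \<open>Y2 = G2 f\<close> for \<open>f\<close> distributed according to \<open>\<mu>\<close>, and let
  \<open>T = m12 (Y1, Y2) - m1 Y1\<close> be the change of the conditional mean caused by the
  second observation. The theorem is a statement about this one random vector.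

  Conditionally on \<open>(Y1, Y2)\<close> the vector \<open>f\<close> is Gaussian around \<open>m12 (Y1, Y2)\<close> with
  covariance \<open>C12\<close>, and conditionally on \<open>Y1\<close> it is Gaussian around \<open>m1 Y1\<close> with
  covariance \<open>C1\<close>. Computing the characteristic function of \<open>f - m1 Y1\<close> in both ways
  and dividing shows that \<open>T\<close> is independent of \<open>Y1\<close> and centred Gaussian with
  covariance \<open>D = C1 - C12\<close>. As the measures \<open>K12 (y1, y2)\<close> live on the fibres of
  \<open>(G1, G2)\<close>, moreover \<open>G2 T = Y2 - G2 (m1 Y1)\<close> almost surely and \<open>C12 (h o G2) = 0\<close>
  for every \<open>h\<close> in the dual. Hence the functionals \<open>e i = ys i o G2\<close> are orthonormal
  for \<open>D\<close>, the vectors \<open>u i = C1 (e i)\<close> are \<open>D (e i)\<close>, and the coefficients in the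
  first series are \<open>e i T\<close>. What remains is that the sum \<open>S n\<close> of the vectors \<open>e i T
  *\<^sub>R u i\<close> over the \<open>i < n\<close> in \<open>I\<close> tends to \<open>T\<close> almost surely, and that the
  rank-one operators sum to \<open>D\<close> in operator norm.

  The almost sure convergence rests on a symmetry. The reflection \<open>2 S n - T\<close> of \<open>T\<close>
  at \<open>S n\<close> has, jointly with \<open>Y1\<close> and the first \<open>n\<close> coefficients, the same law as
  \<open>T\<close> itself (\<open>reflection_invariant\<close>); so given these data \<open>T\<close> is in a ball from
  whose centre \<open>S n\<close> is far with probability at most one half. On the other hand \<open>T\<close>
  is a function of \<open>Y1\<close> and \<open>G2 T\<close>, and the representing property says that \<open>G2 T\<close>
  is determined by all the coefficients, so that the event that \<open>T\<close> is in the ball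
  is nearly decided by finitely many coefficients. A first-exit decomposition turns
  these two facts into \<open>S n \<longlonglongrightarrow> T\<close>
  (\<open>reflection_symmetric_convergence\<close>, \<open>partial_sums_converge\<close>).

  For a functional \<open>g\<close> the variable \<open>g (T - S n)\<close> is centred Gaussian, and its
  variance is bounded in terms of the expectation of \<open>min 1 (norm (T - S
  n))\<^sup>2\<close>, uniformly over the unit ball of the dual. That expectation tends to
  \<open>0\<close> by the almost sure convergence, which gives the convergence in operator norm
  (\<open>rank_one_sums\<close>).

  Two general tools carry this: a norming functional exists for every vector
  (\<open>norming_functional_exists\<close>), so weak information about means and covariances
  determines them and weak measurability implies measurability; and finite Borel
  measures on a separable normed space are determined by their characteristic
  functions (\<open>measure_eqI_cos\<close>). Characteristic functions are used in the real form
  of the integrals of \<open>cos (k x + c)\<close> for all functionals \<open>k\<close> and phases \<open>c\<close>.\<close>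

section \<open>Norming functionals and weak measurability\<close>

definition sublinear :: "('a::real_vector \<Rightarrow> real) \<Rightarrow> bool" where
  "sublinear p \<longleftrightarrow> (\<forall>x y. p (x + y) \<le> p x + p y) \<and> (\<forall>t\<ge>0. \<forall>x. p (t *\<^sub>R x) = t * p x)"

lemma sublinear_add: "sublinear p \<Longrightarrow> p (x + y) \<le> p x + p y"
  and sublinear_scale: "sublinear p \<Longrightarrow> t \<ge> 0 \<Longrightarrow> p (t *\<^sub>R x) = t * p x"
  by (auto simp: sublinear_def)

lemma sublinear_zero: "sublinear p \<Longrightarrow> p 0 = 0"
  using sublinear_scale[of p 0 0] by simp

lemma sublinear_neg: "sublinear p \<Longrightarrow> - p (- x) \<le> p x"
  using sublinear_add[of p x "- x"] sublinear_zero[of p] by simp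

text \<open>The functional \<open>q\<close> replaces \<open>p x\<close> by the infimum of \<open>p (x + t a) - t p a\<close> over \<open>t \<ge> 0\<close>. For a
  minimal \<open>p\<close> this changes nothing, and the last inequality then says that \<open>p\<close> is additive. Applied to
  the norm, the same inequality at \<open>x = - a\<close> makes \<open>q\<close> as negative as possible at \<open>- a\<close>.\<close>

lemma sublinear_decrease:
  fixes p :: "'a::real_vector \<Rightarrow> real"
  assumes p: "sublinear p"
  obtains q where "sublinear q" "\<And>x. q x \<le> p x" "\<And>x. q x \<le> p (x + a) - p a"
proof -
  define q where "q x = (INF t\<in>{0..}. p (x + t *\<^sub>R a) - t * p a)" for x
  have lb: "- p (- x) \<le> p (x + t *\<^sub>R a) - t * p a" if "t \<ge> 0" for x t
    using sublinear_add[OF p, of "x + t *\<^sub>R a" "- x"] sublinear_scale[OF p that, of a] by simp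
  have bdd: "bdd_below ((\<lambda>t. p (x + t *\<^sub>R a) - t * p a) ` {0..})" for x
    by (rule bdd_belowI2[of _ "- p (- x)"]) (use lb in auto)
  have q_le: "q x \<le> p (x + t *\<^sub>R a) - t * p a" if "t \<ge> 0" for x t
    unfolding q_def by (rule cINF_lower[OF bdd]) (use that in auto)
  have q_ge: "c \<le> q x" if "\<And>t. t \<ge> 0 \<Longrightarrow> c \<le> p (x + t *\<^sub>R a) - t * p a" for c x
    unfolding q_def by (rule cINF_greatest) (use that in auto)
  have "sublinear q"
    unfolding sublinear_def
  proof (intro conjI allI impI)
    fix x y
    have *: "q (x + y) - (p (x + s *\<^sub>R a) - s * p a) \<le> p (y + t *\<^sub>R a) - t * p a"
      if "s \<ge> 0" "t \<ge> 0" for s t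
    proof -
      have "q (x + y) \<le> p ((x + y) + (s + t) *\<^sub>R a) - (s + t) * p a"
        by (rule q_le) (use that in auto)
      also have "(x + y) + (s + t) *\<^sub>R a = (x + s *\<^sub>R a) + (y + t *\<^sub>R a)"
        by (simp add: algebra_simps)
      also have "p \<dots> \<le> p (x + s *\<^sub>R a) + p (y + t *\<^sub>R a)"
        by (rule sublinear_add[OF p])
      finally show ?thesis by (simp add: algebra_simps)
    qed
    have "q (x + y) - q y \<le> p (x + s *\<^sub>R a) - s * p a" if "s \<ge> 0" for s
      using q_ge[of "q (x + y) - (p (x + s *\<^sub>R a) - s * p a)" y] *[OF that] by fastforce
    then have "q (x + y) - q y \<le> q x" by (rule q_ge)
    then show "q (x + y) \<le> q x + q y" by simp
  next
    fix t :: real and x assume "t \<ge> 0"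
    have le: "q (r *\<^sub>R z) \<le> r * q z" if r: "r > 0" for r z
    proof -
      have "q (r *\<^sub>R z) / r \<le> p (z + s *\<^sub>R a) - s * p a" if "s \<ge> 0" for s
      proof -
        have "q (r *\<^sub>R z) \<le> p (r *\<^sub>R z + (r * s) *\<^sub>R a) - (r * s) * p a"
          by (rule q_le) (use r that in auto)
        also have "r *\<^sub>R z + (r * s) *\<^sub>R a = r *\<^sub>R (z + s *\<^sub>R a)" by (simp add: algebra_simps)
        also have "p \<dots> = r * p (z + s *\<^sub>R a)" by (rule sublinear_scale[OF p]) (use r in auto)
        finally show ?thesis using r by (simp add: field_simps)
      qed
      then have "q (r *\<^sub>R z) / r \<le> q z" by (rule q_ge)
      then show ?thesis using r by (simp add: field_simps)
    qed
    show "q (t *\<^sub>R x) = t * q x"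
    proof (cases "t = 0")
      case True
      have "q 0 \<le> 0" using q_le[of 0 0] sublinear_zero[OF p] by simp
      moreover have "0 \<le> q 0"
        by (rule q_ge) (use lb[of _ 0] sublinear_zero[OF p] in auto)
      ultimately show ?thesis using True by simp
    next
      case False
      then have t: "t > 0" using \<open>t \<ge> 0\<close> by simp
      have "q x \<le> q (t *\<^sub>R x) / t"
        using le[of "1 / t" "t *\<^sub>R x"] t by simp
      then have "t * q x \<le> q (t *\<^sub>R x)" using t by (simp add: field_simps)
      then show ?thesis using le[OF t, of x] by simp
    qed
  qed
  moreover have "q x \<le> p x" for x using q_le[of 0 x] by simp
  moreover have "q x \<le> p (x + a) - p a" for x using q_le[of 1 x] by simp
  ultimately show ?thesis using that by blast
qed

text \<open>Zorn's lemma applies because a chain of sublinear functionals below \<open>p0\<close> is bounded below pointwise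
  by \<open>- p0 (- x)\<close>, and its pointwise infimum is again sublinear.\<close>

lemma minimal_sublinear:
  fixes p0 :: "'a::real_vector \<Rightarrow> real"
  assumes p0: "sublinear p0"
  obtains p where "sublinear p" "p \<le> p0" "\<And>q. sublinear q \<Longrightarrow> q \<le> p \<Longrightarrow> q = p"
proof -
  define A where "A = {p. sublinear p \<and> p \<le> p0}"
  have "\<exists>m\<in>A. \<forall>a\<in>A. m \<ge> a \<longrightarrow> a = m"
  proof (rule predicate_Zorn)
    show "partial_order_on A (relation_of (\<ge>) A)"
      by (rule partial_order_on_relation_ofI) auto
  next
    fix C assume "C \<in> Chains (relation_of (\<ge>) A)"
    then have CA: "C \<subseteq> A" and total: "\<And>p q. p \<in> C \<Longrightarrow> q \<in> C \<Longrightarrow> p \<le> q \<or> q \<le> p"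
      by (auto simp: Chains_def relation_of_def)
    show "\<exists>u\<in>A. \<forall>a\<in>C. a \<ge> u"
    proof (cases "C = {}")
      case True
      then show ?thesis using p0 by (auto simp: A_def)
    next
      case ne: False
      have sub: "sublinear p" "p \<le> p0" if "p \<in> C" for p using that CA by (auto simp: A_def)
      define u where "u x = (INF p\<in>C. p x)" for x
      have bdd: "bdd_below ((\<lambda>p. p x) ` C)" for x
      proof (rule bdd_belowI2[of _ "- p0 (- x)"])
        fix p assume "p \<in> C"
        then show "- p0 (- x) \<le> p x"
          using sublinear_neg[OF sub(1), of p x] le_funD[OF sub(2), of p "- x"] by fastforce
      qed
      have u_le: "u x \<le> p x" if "p \<in> C" for p x
        unfolding u_def by (rule cINF_lower[OF bdd that])
      have u_ge: "c \<le> u x" if "\<And>p. p \<in> C \<Longrightarrow> c \<le> p x" for c x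
        unfolding u_def by (rule cINF_greatest[OF ne that])
      have "sublinear u"
        unfolding sublinear_def
      proof (intro conjI allI impI)
        fix x y
        have *: "u (x + y) - p x \<le> q y" if p: "p \<in> C" and q: "q \<in> C" for p q
        proof -
          obtain r where r: "r \<in> C" "r \<le> p" "r \<le> q" using total[OF p q] p q by auto
          have "u (x + y) \<le> r x + r y" using u_le[OF r(1)] sublinear_add[OF sub(1)[OF r(1)]]
            by (rule order_trans)
          also have "\<dots> \<le> p x + q y" using r by (intro add_mono) (auto simp: le_fun_def)
          finally show ?thesis by simp
        qed
        have "u (x + y) - u y \<le> p x" if "p \<in> C" for p
          using u_ge[of "u (x + y) - p x" y] *[OF that] by fastforce
        then have "u (x + y) - u y \<le> u x" by (rule u_ge)
        then show "u (x + y) \<le> u x + u y" by simp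
      next
        fix t :: real and x assume t: "t \<ge> 0"
        show "u (t *\<^sub>R x) = t * u x"
        proof (cases "t = 0")
          case True
          have "u 0 = (INF p\<in>C. (0::real))"
            unfolding u_def by (rule INF_cong) (simp_all add: sublinear_zero[OF sub(1)])
          then show ?thesis using ne True by simp
        next
          case False
          then have tp: "t > 0" using t by simp
          have "u (t *\<^sub>R x) / t \<le> u x"
            by (rule u_ge)
              (use u_le[of _ "t *\<^sub>R x"] sublinear_scale[OF sub(1) t] tp in \<open>fastforce simp: field_simps\<close>)
          moreover have "t * u x \<le> u (t *\<^sub>R x)"
            by (rule u_ge) (use u_le[of _ x] sublinear_scale[OF sub(1) t] tp in \<open>fastforce\<close>)
          ultimately show ?thesis using tp by (simp add: field_simps)
        qed
      qed
      moreover have "u \<le> p0"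
        using ne u_le sub(2) by (metis all_not_in_conv le_fun_def order_trans)
      ultimately show ?thesis using u_le by (auto simp: A_def le_fun_def)
    qed
  qed
  then obtain p where "p \<in> A" "\<And>q. q \<in> A \<Longrightarrow> q \<le> p \<Longrightarrow> q = p" by blast
  then show ?thesis using that[of p] by (auto simp: A_def intro: order_trans)
qed

text \<open>The consequence of the Hahn-Banach theorem that is needed here: a minimal sublinear functional is
  linear, and starting below the norm from a functional with value at most \<open>- norm x\<close> at \<open>- x\<close> forces
  the value \<open>norm x\<close> at \<open>x\<close>.\<close>

theorem norming_functional_exists:
  fixes x :: "'a::real_normed_vector"
  shows "\<exists>g :: 'a \<Rightarrow>\<^sub>L real. norm g \<le> 1 \<and> blinfun_apply g x = norm x"
proof -
  have "sublinear (norm :: 'a \<Rightarrow> real)" by (simp add: sublinear_def norm_triangle_ineq)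
  then obtain p0 where p0: "sublinear p0" "\<And>y::'a. p0 y \<le> norm y"
    "\<And>y. p0 y \<le> norm (y + x) - norm x"
    using sublinear_decrease[of norm x] by metis
  obtain p where p: "sublinear p" "p \<le> p0" "\<And>q. sublinear q \<Longrightarrow> q \<le> p \<Longrightarrow> q = p"
    using minimal_sublinear[OF p0(1)] by metis
  have add: "p (y + z) = p y + p z" for y z
  proof -
    obtain q where q: "sublinear q" "\<And>w. q w \<le> p w" "\<And>w. q w \<le> p (w + z) - p z"
      using sublinear_decrease[OF p(1), of z] by metis
    have "q = p" using p(3) q(1,2) by (auto simp: le_fun_def)
    then show ?thesis using q(3)[of y] sublinear_add[OF p(1), of y z] by simp
  qed
  have neg: "p (- y) = - p y" for y
    using add[of y "- y"] sublinear_zero[OF p(1)] by simp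
  have scale: "p (t *\<^sub>R y) = t *\<^sub>R p y" for t y
  proof (cases "t \<ge> 0")
    case False
    have "p (t *\<^sub>R y) = p (- ((- t) *\<^sub>R y))" by simp
    also have "\<dots> = - p ((- t) *\<^sub>R y)" by (rule neg)
    also have "\<dots> = t *\<^sub>R p y" using False sublinear_scale[OF p(1), of "- t" y] by simp
    finally show ?thesis .
  qed (simp add: sublinear_scale[OF p(1)])
  have le: "p y \<le> norm y" for y using p(2) p0(2) by (metis le_funD order_trans)
  have bnd: "norm (p y) \<le> norm y * 1" for y
    using le[of y] le[of "- y"] neg[of y] by (simp add: abs_le_iff)
  have lin: "bounded_linear p"
    by (rule bounded_linear_intro[OF add scale bnd])
  have "p (- x) \<le> - norm x"
    using p0(3)[of "- x"] le_funD[OF p(2), of "- x"] by simp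
  then have "p x = norm x" using neg[of x] le[of x] by simp
  moreover have "norm (Blinfun p) \<le> 1"
    by (rule norm_blinfun_bound) (use bnd in \<open>auto simp: bounded_linear_Blinfun_apply[OF lin]\<close>)
  ultimately show ?thesis
    by (intro exI[of _ "Blinfun p"]) (simp add: bounded_linear_Blinfun_apply[OF lin])
qed

lemma dual_separates_points:
  fixes x y :: "'a::real_normed_vector"
  assumes "\<And>g :: 'a \<Rightarrow>\<^sub>L real. blinfun_apply g x = blinfun_apply g y"
  shows "x = y"
  using norming_functional_exists[of "x - y"] assms by (auto simp: blinfun.diff_right)

text \<open>Norming functionals of a countable dense set suffice, because functionals of norm at most one
  change little under small perturbations of their argument.\<close>

lemma countable_norming_functionals:
  obtains g :: "nat \<Rightarrow> 'a::{real_normed_vector, second_countable_topology} \<Rightarrow>\<^sub>L real"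
  where "\<And>v r. norm v \<le> r \<longleftrightarrow> (\<forall>n. blinfun_apply (g n) v \<le> r)"
proof -
  obtain D :: "'a set" where D: "countable D" "\<And>X. open X \<Longrightarrow> X \<noteq> {} \<Longrightarrow> \<exists>d\<in>D. d \<in> X"
    by (rule countable_dense_setE) blast
  have ne: "D \<noteq> {}" using D(2)[of UNIV] by auto
  obtain f :: "'a \<Rightarrow> 'a \<Rightarrow>\<^sub>L real" where f: "\<And>x. norm (f x) \<le> 1" "\<And>x. blinfun_apply (f x) x = norm x"
    using norming_functional_exists by metis
  have bound: "blinfun_apply (f x) v \<le> norm v" for x v
    using norm_blinfun[of "f x" v] f(1)[of x] mult_right_mono[OF f(1)[of x], of "norm v"] by simp
  have "norm v \<le> r" if *: "\<forall>n. blinfun_apply (f (from_nat_into D n)) v \<le> r" for v r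
  proof (rule field_le_epsilon)
    fix e :: real assume "e > 0"
    then obtain d where d: "d \<in> D" "dist v d < e / 2"
      using D(2)[of "ball v (e / 2)"] by auto
    have "norm v \<le> norm d + norm (v - d)" by (metis add.commute norm_triangle_sub)
    also have "norm d = blinfun_apply (f d) v + blinfun_apply (f d) (d - v)"
      by (simp add: blinfun.diff_right f)
    also have "blinfun_apply (f d) v \<le> r"
      using * d(1) from_nat_into_surj[OF D(1)] by metis
    also have "blinfun_apply (f d) (d - v) \<le> norm (v - d)"
      using bound[of d "d - v"] by (simp add: norm_minus_commute)
    finally show "norm v \<le> r + e" using d(2) by (simp add: dist_norm)
  qed
  then have "norm v \<le> r \<longleftrightarrow> (\<forall>n. blinfun_apply (f (from_nat_into D n)) v \<le> r)" for v r
    using bound order_trans by blast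
  then show ?thesis using that[of "\<lambda>n. f (from_nat_into D n)"] by blast
qed

text \<open>Closed balls are countable intersections of half-spaces given by the norming functionals, and by
  separability every open set is a countable union of balls.\<close>

lemma borel_measurable_norming_functionals:
  fixes f :: "'w \<Rightarrow> 'a::{real_normed_vector, second_countable_topology}"
  assumes g: "\<And>v r. norm v \<le> r \<longleftrightarrow> (\<forall>n::nat. blinfun_apply (g n) v \<le> r)"
    and meas: "\<And>n. (\<lambda>w. blinfun_apply (g n) (f w)) \<in> borel_measurable M"
  shows "f \<in> borel_measurable M"
proof (rule borel_measurableI)
  fix U :: "'a set" assume U: "open U"
  define \<F> where "\<F> = {ball x r |x r. cball x r \<subseteq> U}"
  have UF: "\<Union>\<F> = U"
  proof (intro equalityI subsetI)
    fix x assume "x \<in> U"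
    then obtain e where "e > 0" "cball x e \<subseteq> U" using U open_contains_cball by blast
    then show "x \<in> \<Union>\<F>" by (auto simp: \<F>_def intro!: exI[of _ "ball x e"])
  qed (auto simp: \<F>_def)
  obtain \<F>' where F': "\<F>' \<subseteq> \<F>" "countable \<F>'" "\<Union>\<F>' = \<Union>\<F>"
    by (rule Lindelof[of \<F>]) (auto simp: \<F>_def)
  have "f -` B \<inter> space M \<in> sets M" if BF: "B \<in> \<F>'" for B
  proof -
    obtain x r where B: "B = ball x r" using F'(1) BF unfolding \<F>_def by blast
    have eq: "B = (\<Union>k::nat. cball x (r - 1 / Suc k))"
    proof (intro equalityI subsetI)
      fix y assume "y \<in> B"
      then have "0 < r - dist x y" by (simp add: B)
      then obtain k where "1 / real (Suc k) < r - dist x y" using nat_approx_posE by blast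
      then have "y \<in> cball x (r - 1 / Suc k)" by simp
      then show "y \<in> (\<Union>k::nat. cball x (r - 1 / Suc k))" by blast
    next
      fix y assume "y \<in> (\<Union>k::nat. cball x (r - 1 / Suc k))"
      then obtain k :: nat where "dist x y \<le> r - 1 / Suc k" by auto
      also have "\<dots> < r" by simp
      finally show "y \<in> B" by (simp add: B)
    qed
    have cb: "f -` cball x s \<inter> space M = {w\<in>space M. \<forall>n. blinfun_apply (g n) (f w) - blinfun_apply (g n) x \<le> s}" for s
      using g[of "f w - x" s for w] by (auto simp: dist_norm norm_minus_commute blinfun.diff_right)
    have "f -` cball x s \<inter> space M \<in> sets M" for s
      unfolding cb using meas by measurable
    then have "(\<Union>k::nat. f -` cball x (r - 1 / Suc k) \<inter> space M) \<in> sets M"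
      by (intro sets.countable_UN) blast
    moreover have "f -` B \<inter> space M = (\<Union>k::nat. f -` cball x (r - 1 / Suc k) \<inter> space M)"
      unfolding eq by blast
    ultimately show ?thesis by simp
  qed
  then have "(\<Union>B\<in>\<F>'. f -` B \<inter> space M) \<in> sets M"
    using F'(2) by blast
  also have "(\<Union>B\<in>\<F>'. f -` B \<inter> space M) = f -` U \<inter> space M" using F'(3) UF by blast
  finally show "f -` U \<inter> space M \<in> sets M" .
qed

lemma borel_measurable_weakly:
  fixes f :: "'w \<Rightarrow> 'a::{real_normed_vector, second_countable_topology}"
  assumes "\<And>g :: 'a \<Rightarrow>\<^sub>L real. (\<lambda>w. blinfun_apply g (f w)) \<in> borel_measurable M"
  shows "f \<in> borel_measurable M"
proof -
  obtain g :: "nat \<Rightarrow> 'a \<Rightarrow>\<^sub>L real" where "\<And>v r. norm v \<le> r \<longleftrightarrow> (\<forall>n. blinfun_apply (g n) v \<le> r)"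
    by (rule countable_norming_functionals) blast
  then show ?thesis using assms by (rule borel_measurable_norming_functionals)
qed

section \<open>Uniqueness of measures with given characteristic function\<close>

lemma integral_iexp_eq_cos_sin:
  assumes "finite_measure M" and f[measurable]: "f \<in> borel_measurable M"
  shows "(CLINT x|M. iexp (f x)) = Complex (\<integral>x. cos (f x) \<partial>M) (\<integral>x. cos (f x - pi / 2) \<partial>M)"
proof -
  interpret finite_measure M by fact
  have int: "integrable M (\<lambda>x. iexp (f x))"
    by (rule integrable_const_bound[where B=1]) auto
  show ?thesis
  proof (rule complex_eqI)
    show "Re (CLINT x|M. iexp (f x)) = Re (Complex (\<integral>x. cos (f x) \<partial>M) (\<integral>x. cos (f x - pi / 2) \<partial>M))"
      using int by (simp add: integral_Re[symmetric] cos_of_real sin_of_real exp_Euler)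
    show "Im (CLINT x|M. iexp (f x)) = Im (Complex (\<integral>x. cos (f x) \<partial>M) (\<integral>x. cos (f x - pi / 2) \<partial>M))"
      using int by (simp add: integral_Im[symmetric] cos_diff exp_Euler cos_of_real sin_of_real)
  qed
qed

text \<open>Levy's uniqueness theorem after normalising the common total mass, which is the integral of
  \<open>cos (0 x + 0)\<close>.\<close>

lemma real_measure_eqI_cos:
  fixes M N :: "real measure"
  assumes fin: "finite_measure M" "finite_measure N" and sets[simp, measurable_cong]: "sets M = sets borel" "sets N = sets borel"
    and eq: "\<And>s c. (\<integral>x. cos (s * x + c) \<partial>M) = (\<integral>x. cos (s * x + c) \<partial>N)"
  shows "M = N"
proof -
  interpret M: finite_measure M by fact
  interpret N: finite_measure N by fact
  have sp[simp]: "space M = UNIV" "space N = UNIV"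
    using sets_eq_imp_space_eq[OF sets(1)] sets_eq_imp_space_eq[OF sets(2)] by auto
  define a where "a = measure M UNIV"
  have a: "a = measure N UNIV" using eq[of 0 0] by (simp add: a_def)
  have emM: "emeasure M UNIV = ennreal a" using M.emeasure_eq_measure by (simp add: a_def)
  have emN: "emeasure N UNIV = ennreal a" using N.emeasure_eq_measure by (simp add: a)
  show ?thesis
  proof (cases "a = 0")
    case True
    have "emeasure M A = 0" "emeasure N A = 0" for A
      using emeasure_mono[of A UNIV M] emeasure_mono[of A UNIV N] emM emN True
      by (auto simp: subset_UNIV)
    then show ?thesis by (intro measure_eqI) auto
  next
    case False
    then have pos: "a > 0" using measure_nonneg[of M UNIV] by (simp add: a_def less_le)
    define M' where "M' = density M (\<lambda>_. ennreal (1 / a))"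
    define N' where "N' = density N (\<lambda>_. ennreal (1 / a))"
    have e: "ennreal (1 / a) * ennreal a = 1"
      using pos by (simp add: ennreal_mult[symmetric])
    have pM: "prob_space M'" by standard (simp add: M'_def emeasure_density emM e)
    have pN: "prob_space N'" by standard (simp add: N'_def emeasure_density emN e)
    have rM: "real_distribution M'" and rN: "real_distribution N'"
      using pM pN by (auto simp: real_distribution_def real_distribution_axioms_def M'_def N'_def)
    have sM: "density M' (\<lambda>_. ennreal a) = M" and sN: "density N' (\<lambda>_. ennreal a) = N"
      using e by (simp_all add: M'_def N'_def density_density_eq density_1)
    have sc: "(\<integral>x. f x \<partial>density L (\<lambda>_. ennreal (1 / a))) = (\<integral>x. f x \<partial>L) /\<^sub>R a"
      if [measurable]: "f \<in> borel_measurable L" for f :: "real \<Rightarrow> complex" and L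
      using pos by (subst integral_density) (auto simp: inverse_eq_divide)
    have "char M' t = char N' t" for t
    proof -
      have tm: "(\<lambda>x. t * x) \<in> borel_measurable M" "(\<lambda>x. t * x) \<in> borel_measurable N"
        by (simp_all add: measurable_cong_sets[OF sets(1) refl] measurable_cong_sets[OF sets(2) refl])
      have "char M t = char N t"
        unfolding char_def using eq[of t 0] eq[of t "- pi / 2"]
        using integral_iexp_eq_cos_sin[OF fin(1) tm(1)] integral_iexp_eq_cos_sin[OF fin(2) tm(2)]
        by simp
      then show ?thesis unfolding char_def M'_def N'_def by (subst (1 2) sc) (auto, measurable)
    qed
    then have "M' = N'" by (intro Levy_uniqueness rM rN ext)
    then show ?thesis using sM sN by simp
  qed
qed

text \<open>The weighted law of a real random variable is a finite measure on the line, so the one-dimensional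
  uniqueness theorem lets the test functions \<open>cos (s X + c)\<close> be replaced by indicator functions
  while the weight stays.\<close>

lemma weighted_law_eq:
  fixes w :: "'w \<Rightarrow> real" and X :: "'w \<Rightarrow> real"
  assumes fin: "finite_measure M" "finite_measure N" and sets: "sets N = sets M"
    and w[measurable]: "w \<in> borel_measurable M" and X[measurable]: "X \<in> borel_measurable M"
    and w0: "\<And>x. 0 \<le> w x" and wb: "\<And>x. w x \<le> b"
    and eq: "\<And>s c. (\<integral>x. w x * cos (s * X x + c) \<partial>M) = (\<integral>x. w x * cos (s * X x + c) \<partial>N)"
    and B[measurable]: "B \<in> sets borel"
  shows "(\<integral>x. w x * indicator B (X x) \<partial>M) = (\<integral>x. w x * indicator B (X x) \<partial>N)"
proof -
  have [measurable]: "w \<in> borel_measurable N" "X \<in> borel_measurable N"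
    using w X by (simp_all add: measurable_cong_sets[OF sets refl])
  have trans: "(\<integral>x. f x \<partial>distr (density L (\<lambda>x. ennreal (w x))) borel X) = (\<integral>x. w x * f (X x) \<partial>L)"
    if [measurable]: "w \<in> borel_measurable L" "X \<in> borel_measurable L" "f \<in> borel_measurable borel"
    for L and f :: "real \<Rightarrow> real"
    by (subst integral_distr) (auto simp: integral_density w0)
  have fin': "finite_measure (distr (density L (\<lambda>x. ennreal (w x))) borel X)"
    if [measurable]: "w \<in> borel_measurable L" "X \<in> borel_measurable L" and L: "finite_measure L" for L
  proof -
    interpret finite_measure L by fact
    have "emeasure (density L (\<lambda>x. ennreal (w x))) (space L) = (\<integral>\<^sup>+x. ennreal (w x) \<partial>L)"
      by (subst emeasure_density) (auto intro!: nn_integral_cong)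
    also have "\<dots> \<le> (\<integral>\<^sup>+x. ennreal b \<partial>L)"
      by (intro nn_integral_mono ennreal_leI wb)
    also have "\<dots> < \<infinity>" by (simp add: emeasure_eq_measure ennreal_mult_less_top)
    finally have "finite_measure (density L (\<lambda>x. ennreal (w x)))"
      by (intro finite_measureI) simp
    then show ?thesis by (rule finite_measure.finite_measure_distr) simp
  qed
  have "distr (density M (\<lambda>x. ennreal (w x))) borel X = distr (density N (\<lambda>x. ennreal (w x))) borel X"
    by (rule real_measure_eqI_cos) (auto intro!: fin' fin simp: trans eq)
  then have "(\<integral>x. indicator B x \<partial>distr (density M (\<lambda>x. ennreal (w x))) borel X) =
    (\<integral>x. (indicator B x::real) \<partial>distr (density N (\<lambda>x. ennreal (w x))) borel X)" by simp
  then show ?thesis using trans[of M "indicator B"] trans[of N "indicator B"] by simp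
qed

text \<open>Indicator functions of a cylinder are introduced one functional at a time, while
  \<open>cos (k x + c)\<close> is kept as a spectator. In the induction step the spectator enters through the weight
  \<open>1 + cos (h x + d)\<close>, which is nonnegative, and products of cosines are sums of cosines of functionals
  again.\<close>

lemma cylinder_cos_integrals_eq:
  fixes M N :: "'a::real_normed_vector measure" and g :: "'j \<Rightarrow> 'a \<Rightarrow>\<^sub>L real" and k :: "'a \<Rightarrow>\<^sub>L real"
  assumes fin: "finite_measure M" "finite_measure N" and sets: "sets M = sets borel" "sets N = sets borel"
    and eq: "\<And>(k :: 'a \<Rightarrow>\<^sub>L real) c. (\<integral>x. cos (blinfun_apply k x + c) \<partial>M) = (\<integral>x. cos (blinfun_apply k x + c) \<partial>N)"
    and J: "finite J" and B: "\<And>j. j \<in> J \<Longrightarrow> B j \<in> sets borel"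
  shows "(\<integral>x. (\<Prod>j\<in>J. indicator (B j) (blinfun_apply (g j) x)) * cos (blinfun_apply k x + c) \<partial>M) =
    (\<integral>x. (\<Prod>j\<in>J. indicator (B j) (blinfun_apply (g j) x)) * cos (blinfun_apply k x + c) \<partial>N)"
  using J B
proof (induction J arbitrary: k c rule: finite_induct)
  case empty
  then show ?case using eq[of k c] by simp
next
  case (insert i J)
  have mb: "blinfun_apply h \<in> borel_measurable borel" for h :: "'a \<Rightarrow>\<^sub>L real"
    by (intro borel_measurable_continuous_onI continuous_intros)
  have [measurable]: "blinfun_apply h \<in> borel_measurable M" "blinfun_apply h \<in> borel_measurable N"
    for h :: "'a \<Rightarrow>\<^sub>L real"
    using mb by (simp_all add: measurable_cong_sets[OF sets(1) refl] measurable_cong_sets[OF sets(2) refl])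
  have [measurable]: "\<And>j. j \<in> insert i J \<Longrightarrow> B j \<in> sets borel" by (rule insert.prems)
  define p :: "'a \<Rightarrow> real" where "p x = (\<Prod>j\<in>J. indicator (B j) (blinfun_apply (g j) x))" for x
  have pm[measurable]: "p \<in> borel_measurable M" "p \<in> borel_measurable N"
    unfolding p_def by measurable
  have p01: "0 \<le> p x" "p x \<le> 1" for x
    unfolding p_def by (auto intro!: prod_nonneg prod_le_1 simp: indicator_def)
  have int: "integrable L (\<lambda>x. p x * f x)"
    if "finite_measure L" "p \<in> borel_measurable L" "f \<in> borel_measurable L" "\<And>x. \<bar>f x\<bar> \<le> 1" for L f
  proof -
    interpret finite_measure L by fact
    have "\<bar>p x * f x\<bar> \<le> 1" for x
      using mult_mono[of "\<bar>p x\<bar>" 1 "\<bar>f x\<bar>" 1] p01[of x] that(4)[of x] by (simp add: abs_mult)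
    then show ?thesis using that by (intro integrable_const_bound[where B=1]) auto
  qed
  have IH: "(\<integral>x. p x * cos (blinfun_apply k x + c) \<partial>M) = (\<integral>x. p x * cos (blinfun_apply k x + c) \<partial>N)" for k c
    unfolding p_def by (rule insert.IH) (use insert.prems in auto)
  have exp: "(\<integral>x. p x * (1 + cos (blinfun_apply h x + d)) * cos (s * blinfun_apply (g i) x + c) \<partial>L) =
      (\<integral>x. p x * cos (blinfun_apply (s *\<^sub>R g i) x + c) \<partial>L)
      + ((\<integral>x. p x * cos (blinfun_apply (h + s *\<^sub>R g i) x + (d + c)) \<partial>L)
      + (\<integral>x. p x * cos (blinfun_apply (h - s *\<^sub>R g i) x + (d - c)) \<partial>L)) / 2"
    if L: "finite_measure L" "p \<in> borel_measurable L" "\<And>h :: 'a \<Rightarrow>\<^sub>L real. blinfun_apply h \<in> borel_measurable L" for L h d s c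
  proof -
    note [measurable] = L(2,3)
    have "p x * (1 + cos (blinfun_apply h x + d)) * cos (s * blinfun_apply (g i) x + c) =
      p x * cos (blinfun_apply (s *\<^sub>R g i) x + c)
      + (p x * cos (blinfun_apply (h + s *\<^sub>R g i) x + (d + c))
      + p x * cos (blinfun_apply (h - s *\<^sub>R g i) x + (d - c))) / 2" for x
      using cos_times_cos[of "blinfun_apply h x + d" "s * blinfun_apply (g i) x + c"]
      by (simp add: blinfun.add_left blinfun.diff_left blinfun.scaleR_left algebra_simps)
    moreover have "integrable L (\<lambda>x. p x * cos (blinfun_apply k x + c))" for k c
      by (rule int[OF L(1,2) measurable_compose[OF L(3)[of k], of "\<lambda>r. cos (r + c)"]]) auto
    ultimately show ?thesis by simp
  qed
  have c0: "0 \<le> 1 + cos r" for r :: real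
    using cos_ge_minus_one[of r] by linarith
  have step: "(\<integral>x. p x * (1 + cos (blinfun_apply h x + d)) * indicator (B i) (blinfun_apply (g i) x) \<partial>M) =
      (\<integral>x. p x * (1 + cos (blinfun_apply h x + d)) * indicator (B i) (blinfun_apply (g i) x) \<partial>N)" for h d
  proof (rule weighted_law_eq[where b=2])
    show "p x * (1 + cos (blinfun_apply h x + d)) \<le> 2" for x
      using mult_mono[OF p01(2)[of x], of "1 + cos (blinfun_apply h x + d)" 2] p01[of x]
        c0 by simp
    show "0 \<le> p x * (1 + cos (blinfun_apply h x + d))" for x
      using p01 c0 by (intro mult_nonneg_nonneg)
    show "(\<integral>x. p x * (1 + cos (blinfun_apply h x + d)) * cos (s * blinfun_apply (g i) x + c) \<partial>M) =
        (\<integral>x. p x * (1 + cos (blinfun_apply h x + d)) * cos (s * blinfun_apply (g i) x + c) \<partial>N)" for s c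
      by (simp add: exp fin IH)
  qed (use insert.prems in \<open>auto simp: fin sets\<close>)
  let ?I = "\<lambda>x. indicator (B i) (blinfun_apply (g i) x) :: real"
  have spl: "(\<integral>x. p x * (1 + cos (blinfun_apply h x + d)) * ?I x \<partial>L) =
      (\<integral>x. p x * ?I x \<partial>L) + (\<integral>x. p x * (?I x * cos (blinfun_apply h x + d)) \<partial>L)"
    if L: "finite_measure L" "p \<in> borel_measurable L" "\<And>h :: 'a \<Rightarrow>\<^sub>L real. blinfun_apply h \<in> borel_measurable L" for L h d
  proof -
    note [measurable] = L(2,3)
    have "p x * (1 + cos (blinfun_apply h x + d)) * ?I x = p x * ?I x + p x * (?I x * cos (blinfun_apply h x + d))" for x
      by (simp add: algebra_simps)
    then show ?thesis
      using int[OF L(1,2), of "?I"] int[OF L(1,2), of "\<lambda>x. ?I x * cos (blinfun_apply h x + d)"]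
      by (simp add: indicator_def)
  qed
  \<comment> \<open>The phase \<open>pi / 2\<close> removes the cosine and leaves the bare weight.\<close>
  have base: "(\<integral>x. p x * ?I x \<partial>M) = (\<integral>x. p x * ?I x \<partial>N)"
    using step[of 0 "pi / 2"] by simp
  have "(\<integral>x. p x * (?I x * cos (blinfun_apply k x + c)) \<partial>M) = (\<integral>x. p x * (?I x * cos (blinfun_apply k x + c)) \<partial>N)"
    using step[of k c] base spl[OF fin(1)] spl[OF fin(2)] by simp
  moreover have "(\<Prod>j\<in>insert i J. indicator (B j) (blinfun_apply (g j) x)) * cos (blinfun_apply k x + c) =
      p x * (?I x * cos (blinfun_apply k x + c))" for x
    using insert.hyps by (simp add: p_def mult_ac)
  ultimately show ?case by (simp only:)
qed

text \<open>The countably many norming functionals embed the space into a product of real lines and generate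
  its Borel sets, so two measures agree as soon as they agree on cylinders.\<close>

theorem measure_eqI_cos:
  fixes M N :: "'a::{real_normed_vector, second_countable_topology} measure"
  assumes fin: "finite_measure M" "finite_measure N" and sets[measurable_cong]: "sets M = sets borel" "sets N = sets borel"
    and eq: "\<And>(k :: 'a \<Rightarrow>\<^sub>L real) c. (\<integral>x. cos (blinfun_apply k x + c) \<partial>M) = (\<integral>x. cos (blinfun_apply k x + c) \<partial>N)"
  shows "M = N"
proof -
  interpret M: finite_measure M by fact
  interpret N: finite_measure N by fact
  obtain g :: "nat \<Rightarrow> 'a \<Rightarrow>\<^sub>L real" where g: "\<And>v r. norm v \<le> r \<longleftrightarrow> (\<forall>n. blinfun_apply (g n) v \<le> r)"
    by (rule countable_norming_functionals) blast
  let ?P = "PiM UNIV (\<lambda>_::nat. borel :: real measure)"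
  define \<Phi> where "\<Phi> x = (\<lambda>n. blinfun_apply (g n) x)" for x
  have mb: "blinfun_apply h \<in> borel_measurable borel" for h :: "'a \<Rightarrow>\<^sub>L real"
    by (intro borel_measurable_continuous_onI continuous_intros)
  have \<Phi>b: "\<Phi> \<in> measurable borel ?P"
    unfolding \<Phi>_def by (rule measurable_PiM_single') (auto simp: mb)
  then have \<Phi>[measurable]: "\<Phi> \<in> measurable M ?P" "\<Phi> \<in> measurable N ?P" by measurable
  have sp: "space M = UNIV" "space N = UNIV"
    using sets_eq_imp_space_eq[OF sets(1)] sets_eq_imp_space_eq[OF sets(2)] by auto
  have "distr M ?P \<Phi> = distr N ?P \<Phi>"
  proof (rule measure_eqI_PiM_infinite)
    fix A and J :: "nat set" assume J: "finite J" and A: "\<And>i. i \<in> J \<Longrightarrow> A i \<in> sets (borel :: real measure)"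
    let ?E = "prod_emb UNIV (\<lambda>_. borel) J (Pi\<^sub>E J A)"
    have E[measurable]: "?E \<in> sets ?P" using J A by (intro sets_PiM_I) auto
    have Ei: "indicator (\<Phi> -` ?E) x = (\<Prod>j\<in>J. indicator (A j) (blinfun_apply (g j) x) :: real)" for x
      using J by (auto simp: \<Phi>_def prod_emb_def indicator_def prod_zero_iff PiE_iff)
    have "measure L (\<Phi> -` ?E) = (\<integral>x. (\<Prod>j\<in>J. indicator (A j) (blinfun_apply (g j) x)) * cos (blinfun_apply 0 x + 0) \<partial>L)"
      if "space L = UNIV" "\<Phi> \<in> measurable L ?P" for L
      using measurable_sets[OF that(2) E] that(1) by (simp add: Ei[symmetric])
    from this[OF sp(1) \<Phi>(1)] this[OF sp(2) \<Phi>(2)]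
    have "measure M (\<Phi> -` ?E) = measure N (\<Phi> -` ?E)"
      using cylinder_cos_integrals_eq[OF fin sets eq J A, where g=g and k=0 and c=0] by simp
    then show "emeasure (distr M ?P \<Phi>) ?E = emeasure (distr N ?P \<Phi>) ?E"
      by (simp add: emeasure_distr M.emeasure_eq_measure N.emeasure_eq_measure sp)
  qed (auto intro!: M.finite_measure_distr)
  note law = this
  show ?thesis
  proof (rule measure_eqI)
    fix A assume "A \<in> sets M"
    then have A: "A \<in> sets borel" by (simp add: sets)
    have "(\<lambda>x. x) \<in> borel_measurable (vimage_algebra UNIV \<Phi> ?P)"
    proof (rule borel_measurable_norming_functionals[OF g])
      fix n
      have "\<Phi> \<in> measurable (vimage_algebra UNIV \<Phi> ?P) ?P"
        by (rule measurable_vimage_algebra1) (auto simp: space_PiM)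
      then have "(\<lambda>x. \<Phi> x n) \<in> borel_measurable (vimage_algebra UNIV \<Phi> ?P)" by measurable
      then show "(\<lambda>x. blinfun_apply (g n) x) \<in> borel_measurable (vimage_algebra UNIV \<Phi> ?P)"
        by (simp add: \<Phi>_def)
    qed
    from measurable_sets[OF this A] have "A \<in> sets (vimage_algebra UNIV \<Phi> ?P)" by simp
    then obtain C where C: "C \<in> sets ?P" "A = \<Phi> -` C"
      by (auto simp: sets_vimage_algebra2 space_PiM)
    have "emeasure M A = emeasure (distr M ?P \<Phi>) C" using C by (simp add: emeasure_distr sp)
    also have "\<dots> = emeasure N A" unfolding law using C by (simp add: emeasure_distr sp)
    finally show "emeasure M A = emeasure N A" .
  qed (simp add: sets)
qed

section \<open>Convergence from reflection symmetry\<close>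

text \<open>These are the events of the completed sigma-algebra generated by the algebras \<open>F n\<close>, described by
  approximation in measure. This form serves both purposes below: limits in probability of variables
  observed by some \<open>F n\<close> are measurable for it, and its members are almost decided at a finite time.\<close>

definition approximable :: "'w measure \<Rightarrow> (nat \<Rightarrow> 'w set set) \<Rightarrow> 'w set set" where
  "approximable M F =
     {B \<in> sets M. \<forall>e>0. \<exists>n. \<exists>E\<in>F n. measure M ((B - E) \<union> (E - B)) < e}"

locale filtered_prob_space = prob_space M for M :: "'w measure" +
  fixes F :: "nat \<Rightarrow> 'w set set"
  assumes F_algebra: "algebra (space M) (F n)"
    and F_mono: "m \<le> n \<Longrightarrow> F m \<subseteq> F n"
    and F_sets: "F n \<subseteq> sets M"
begin

lemma approximableD:
  assumes "B \<in> approximable M F" "e > 0"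
  obtains n E where "E \<in> F n" "E \<in> sets M" "prob ((B - E) \<union> (E - B)) < e"
  using assms F_sets unfolding approximable_def by blast

lemma approximable_sets: "B \<in> approximable M F \<Longrightarrow> B \<in> sets M"
  by (simp add: approximable_def)

lemma F_approximable: "E \<in> F n \<Longrightarrow> E \<in> approximable M F"
  using F_sets by (auto simp: approximable_def intro!: exI[of _ n] bexI[of _ E])

lemma approximable_Un:
  assumes A: "A \<in> approximable M F" and B: "B \<in> approximable M F"
  shows "A \<union> B \<in> approximable M F"
  unfolding approximable_def
proof (intro CollectI conjI allI impI)
  show "A \<union> B \<in> sets M" using A B approximable_sets by blast
next
  fix e :: real assume "e > 0"
  then have e: "e / 2 > 0" by simp
  obtain m C where C: "C \<in> F m" "C \<in> sets M" "prob ((A - C) \<union> (C - A)) < e / 2"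
    by (rule approximableD[OF A e])
  obtain n D where D: "D \<in> F n" "D \<in> sets M" "prob ((B - D) \<union> (D - B)) < e / 2"
    by (rule approximableD[OF B e])
  note [measurable] = C(2) D(2) approximable_sets[OF A] approximable_sets[OF B]
  interpret Fn: algebra "space M" "F (max m n)" by (rule F_algebra)
  have "C \<union> D \<in> F (max m n)"
    using C(1) D(1) F_mono[of m "max m n"] F_mono[of n "max m n"] by (intro Fn.Un) auto
  moreover have "prob ((A \<union> B - (C \<union> D)) \<union> ((C \<union> D) - (A \<union> B))) \<le>
      prob (((A - C) \<union> (C - A)) \<union> ((B - D) \<union> (D - B)))"
    by (rule finite_measure_mono) auto
  moreover have "\<dots> \<le> prob ((A - C) \<union> (C - A)) + prob ((B - D) \<union> (D - B))"
    by (rule measure_Un_le) measurable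
  ultimately show "\<exists>n. \<exists>E\<in>F n. prob ((A \<union> B - E) \<union> (E - (A \<union> B))) < e"
    using C(3) D(3) by (intro exI[of _ "max m n"] bexI[of _ "C \<union> D"]) linarith+
qed

lemma approximable_null_modification:
  assumes A: "A \<in> approximable M F" and B: "B \<in> sets M" and ae: "AE w in M. w \<in> A \<longleftrightarrow> w \<in> B"
  shows "B \<in> approximable M F"
  unfolding approximable_def
proof (safe intro!: B)
  fix e :: real assume "e > 0"
  obtain m C where C: "C \<in> F m" "C \<in> sets M" "prob ((A - C) \<union> (C - A)) < e"
    by (rule approximableD[OF A \<open>e > 0\<close>])
  note [measurable] = C(2) approximable_sets[OF A] B
  have "prob ((B - C) \<union> (C - B)) = prob ((A - C) \<union> (C - A))"
    by (rule finite_measure_eq_AE) (use ae in auto)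
  then show "\<exists>n. \<exists>E\<in>F n. prob ((B - E) \<union> (E - B)) < e" using C by metis
qed

lemma sigma_algebra_approximable: "sigma_algebra (space M) (approximable M F)"
  unfolding sigma_algebra_iff2
proof (intro conjI ballI allI impI)
  show "approximable M F \<subseteq> Pow (space M)"
    using approximable_sets sets.sets_into_space by auto
  interpret F0: algebra "space M" "F 0" by (rule F_algebra)
  show empty: "{} \<in> approximable M F" by (rule F_approximable[OF F0.empty_sets])
  show "space M - A \<in> approximable M F" if A: "A \<in> approximable M F" for A
    unfolding approximable_def
  proof (intro CollectI conjI allI impI)
    show "space M - A \<in> sets M" using A approximable_sets by blast
  next
    fix e :: real assume "e > 0"
    obtain m C where C: "C \<in> F m" "C \<in> sets M" "prob ((A - C) \<union> (C - A)) < e"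
      by (rule approximableD[OF A \<open>e > 0\<close>])
    interpret Fm: algebra "space M" "F m" by (rule F_algebra)
    have "(space M - A - (space M - C)) \<union> (space M - C - (space M - A)) = (A - C) \<union> (C - A)"
      using sets.sets_into_space[OF C(2)] sets.sets_into_space[OF approximable_sets[OF A]] by auto
    then show "\<exists>n. \<exists>E\<in>F n. prob ((space M - A - E) \<union> (E - (space M - A))) < e"
      using C Fm.compl_sets by (metis (no_types))
  qed
  fix A :: "nat \<Rightarrow> 'w set" assume A: "range A \<subseteq> approximable M F"
  define U where "U n = (\<Union>i<n. A i)" for n
  have U: "U n \<in> approximable M F" for n
    unfolding U_def by (induction n) (use A empty in \<open>auto simp: lessThan_Suc intro!: approximable_Un\<close>)
  have A_sets: "(\<Union>i. A i) \<in> sets M" using A approximable_sets by (intro sets.countable_UN) auto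
  have UA: "(\<Union>n. U n) = (\<Union>i. A i)" unfolding U_def by blast
  have Lim: "(\<lambda>n. prob (U n)) \<longlonglongrightarrow> prob (\<Union>i. A i)"
    unfolding UA[symmetric]
  proof (rule finite_Lim_measure_incseq)
    show "range U \<subseteq> sets M" using U approximable_sets by blast
    show "incseq U" unfolding incseq_def U_def by (intro allI impI UN_mono) auto
  qed
  show "(\<Union>i. A i) \<in> approximable M F"
    unfolding approximable_def
  proof (safe intro!: A_sets)
    fix e :: real assume "e > 0"
    then have e: "e / 2 > 0" by simp
    obtain n where n: "prob (\<Union>i. A i) - prob (U n) < e / 2"
      using LIMSEQ_D[OF Lim e] by (fastforce simp: abs_if split: if_splits)
    obtain m C where C: "C \<in> F m" "C \<in> sets M" "prob ((U n - C) \<union> (C - U n)) < e / 2"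
      by (rule approximableD[OF U e])
    note [measurable] = C(2) A_sets approximable_sets[OF U]
    have sub: "U n \<subseteq> (\<Union>i. A i)" using UA by blast
    have "prob (((\<Union>i. A i) - C) \<union> (C - (\<Union>i. A i))) \<le> prob (((\<Union>i. A i) - U n) \<union> ((U n - C) \<union> (C - U n)))"
      by (rule finite_measure_mono) (use sub in auto)
    also have "\<dots> \<le> prob ((\<Union>i. A i) - U n) + prob ((U n - C) \<union> (C - U n))"
      by (rule measure_Un_le) auto
    also have "prob ((\<Union>i. A i) - U n) = prob (\<Union>i. A i) - prob (U n)"
      by (rule finite_measure_Diff) (use sub in auto)
    finally have "prob (((\<Union>i. A i) - C) \<union> (C - (\<Union>i. A i))) < e" using n C(3) by simp
    then show "\<exists>n. \<exists>E\<in>F n. prob (((\<Union>i. A i) - E) \<union> (E - (\<Union>i. A i))) < e"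
      using C(1) by blast
  qed
qed

text \<open>If \<open>h < a\<close> and \<open>Z n < a - d\<close> disagree, then \<open>h\<close> and \<open>Z n\<close> differ by at least \<open>d\<close> or \<open>h\<close> is in the
  short interval \<open>[a - 2 d, a)\<close>. The latter has small probability for small \<open>d\<close>, even if the law of
  \<open>h\<close> has atoms, because these intervals shrink to the empty set.\<close>

lemma approximable_limit_in_probability:
  fixes h :: "'w \<Rightarrow> real"
  assumes h[measurable]: "h \<in> borel_measurable M"
    and ZF: "\<And>n a. {w\<in>space M. Z n w < a} \<in> F n"
    and lim: "\<And>d. d > 0 \<Longrightarrow> (\<lambda>n. prob {w\<in>space M. d \<le> \<bar>h w - Z n w\<bar>}) \<longlonglongrightarrow> 0"
  shows "h \<in> borel_measurable (sigma (space M) (approximable M F))"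
proof (rule borel_measurableI_less)
  fix a
  have Z[measurable]: "Z n \<in> borel_measurable M" for n
    by (rule borel_measurableI_less) (use ZF F_sets in blast)
  have "{w\<in>space M. h w < a} \<in> approximable M F"
    unfolding approximable_def
  proof (safe)
    fix e :: real assume "e > 0"
    then have e: "e / 2 > 0" by simp
    define W where "W j = {w\<in>space M. a - 1 / Suc j \<le> h w \<and> h w < a}" for j
    have "(\<lambda>j. prob (W j)) \<longlonglongrightarrow> prob (\<Inter>j. W j)"
    proof (rule finite_Lim_measure_decseq)
      have "1 / real (Suc j) \<le> 1 / real (Suc i)" if "i \<le> j" for i j
        using that by (simp add: field_simps)
      then show "decseq W" unfolding W_def decseq_def by fastforce
    qed (auto simp: W_def)
    also have "(\<Inter>j. W j) = {}"
    proof (rule equals0I)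
      fix w assume w: "w \<in> (\<Inter>j. W j)"
      then have "0 < a - h w" by (auto simp: W_def)
      then obtain k where "1 / real (Suc k) < a - h w" using nat_approx_posE by blast
      moreover have "a - 1 / real (Suc k) \<le> h w" using w by (auto simp: W_def)
      ultimately show False by linarith
    qed
    finally have "(\<lambda>j. prob (W j)) \<longlonglongrightarrow> 0" by simp
    from LIMSEQ_D[OF this e] obtain j where j: "prob (W j) < e / 2" by fastforce
    define d where "d = 1 / (2 * real (Suc j))"
    have d: "d > 0" and d2: "2 * d = 1 / real (Suc j)" by (simp_all add: d_def field_simps)
    from LIMSEQ_D[OF lim[OF d] e] obtain n where n: "prob {w\<in>space M. d \<le> \<bar>h w - Z n w\<bar>} < e / 2"
      by fastforce
    let ?E = "{w\<in>space M. Z n w < a - d}" and ?B = "{w\<in>space M. h w < a}"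
    have "(?B - ?E) \<union> (?E - ?B) \<subseteq> W j \<union> {w\<in>space M. d \<le> \<bar>h w - Z n w\<bar>}"
      using d d2 by (auto simp: W_def)
    then have "prob ((?B - ?E) \<union> (?E - ?B)) \<le> prob (W j \<union> {w\<in>space M. d \<le> \<bar>h w - Z n w\<bar>})"
      by (rule finite_measure_mono) (auto simp: W_def)
    also have "\<dots> \<le> prob (W j) + prob {w\<in>space M. d \<le> \<bar>h w - Z n w\<bar>}"
      by (rule measure_Un_le) (auto simp: W_def)
    finally show "\<exists>n. \<exists>E\<in>F n. prob ((?B - E) \<union> (E - ?B)) < e"
      using n j ZF[of n "a - d"] by (intro exI[of _ n] bexI[of _ ?E]) auto
  qed auto
  then show "{w \<in> space (sigma (space M) (approximable M F)). h w < a} \<in> sets (sigma (space M) (approximable M F))"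
    using sigma_algebra.sets_measure_of_eq[OF sigma_algebra_approximable]
    by (simp add: space_measure_of_conv)
qed

text \<open>This does the work of a martingale convergence theorem, using probabilities of events only. Given what is
  known at time \<open>n\<close>, the points \<open>T\<close> and \<open>2 S n - T\<close> are equally likely to be in a ball, and if both
  are, so is their midpoint \<open>S n\<close>. Hence on an event of \<open>F n\<close> on which \<open>S n\<close> is outside of the ball,
  \<open>T\<close> is in the ball with probability at most one half. But the event that \<open>T\<close> is in the ball is almost
  decided at a finite time; so after that time, \<open>S n\<close> leaves the ball with small probability only.\<close>

theorem reflection_symmetric_convergence:
  fixes T :: "'w \<Rightarrow> 'a::{real_normed_vector, second_countable_topology}"
  assumes T[measurable]: "T \<in> borel_measurable M" and S[measurable]: "\<And>n. S n \<in> borel_measurable M"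
    and SF: "\<And>n x r. {w\<in>space M. r \<le> dist (S n w) x} \<in> F n"
    and reflect: "\<And>n E x r. E \<in> F n \<Longrightarrow> prob (E \<inter> {w\<in>space M. dist (T w) x < r}) =
        prob (E \<inter> {w\<in>space M. dist (2 *\<^sub>R S n w - T w) x < r})"
    and approx: "\<And>x r. {w\<in>space M. dist (T w) x < r} \<in> approximable M F"
  shows "AE w in M. (\<lambda>n. S n w) \<longlonglongrightarrow> T w"
proof -
  have half: "prob E \<le> 2 * prob (E - {w\<in>space M. dist (T w) x < r})"
    if E: "E \<in> F n" and far: "E \<subseteq> {w\<in>space M. r \<le> dist (S n w) x}" for E n x r
  proof -
    let ?B = "{w\<in>space M. dist (T w) x < r}" and ?B' = "{w\<in>space M. dist (2 *\<^sub>R S n w - T w) x < r}"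
    have [measurable]: "E \<in> sets M" using E F_sets by blast
    have "?B \<inter> ?B' \<inter> E = {}"
    proof (rule equals0I)
      fix w assume w: "w \<in> ?B \<inter> ?B' \<inter> E"
      have "2 * norm (S n w - x) = norm (2 *\<^sub>R (S n w - x))" by simp
      also have "2 *\<^sub>R (S n w - x) = (T w - x) + (2 *\<^sub>R S n w - T w - x)"
        by (simp add: algebra_simps scaleR_2)
      also have "norm \<dots> \<le> norm (T w - x) + norm (2 *\<^sub>R S n w - T w - x)"
        by (rule norm_triangle_ineq)
      also have "\<dots> < r + r" using w by (intro add_strict_mono) (auto simp: dist_norm)
      finally show False using w far by (auto simp: dist_norm)
    qed
    then have "prob (E \<inter> ?B) + prob (E \<inter> ?B') = prob ((E \<inter> ?B) \<union> (E \<inter> ?B'))"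
      by (intro finite_measure_Union[symmetric]) auto
    also have "\<dots> \<le> prob E" by (rule finite_measure_mono) auto
    finally have "2 * prob (E \<inter> ?B) \<le> prob E" using reflect[OF E, of x r] by simp
    moreover have "prob (E - ?B) = prob E - prob (E \<inter> ?B)"
      by (rule finite_measure_Diff') auto
    ultimately show ?thesis by simp
  qed
  have ev: "AE w in M. dist (T w) x < r \<longrightarrow> (\<forall>\<^sub>F n in sequentially. dist (S n w) x < r)" for x r
  proof -
    define B where "B = {w\<in>space M. dist (T w) x < r}"
    define N where "N n = {w\<in>space M. r \<le> dist (S n w) x}" for n
    have [measurable]: "B \<in> sets M" "\<And>n. N n \<in> sets M" by (simp_all add: B_def N_def)
    define Z where "Z = B \<inter> (\<Inter>k. \<Union>n\<in>{k..}. N n)"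
    have [measurable]: "Z \<in> sets M" unfolding Z_def by measurable
    have "prob Z \<le> 0 + e" if "e > 0" for e
    proof -
      have e: "e / 3 > 0" using that by simp
      obtain k C where C: "C \<in> F k" "C \<in> sets M" "prob ((B - C) \<union> (C - B)) < e / 3"
        by (rule approximableD[OF approx[of x r, folded B_def] e])
      note [measurable] = C(2)
      \<comment> \<open>Within \<open>C\<close>, the first exit from time \<open>k\<close> on happens at time \<open>n + k\<close>. This
        event is known at that time, so the estimate \<open>half\<close> applies to it.\<close>
      define E where "E n = C \<inter> N (n + k) - (\<Union>j\<in>{k..<n + k}. N j)" for n
      have EF: "E n \<in> F (n + k)" for n
      proof -
        interpret Fn: algebra "space M" "F (n + k)" by (rule F_algebra)
        have "N j \<in> F (n + k)" if "j \<le> n + k" for j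
          using SF[of r j x] F_mono[OF that] by (auto simp: N_def)
        moreover have "C \<in> F (n + k)" using C(1) F_mono[of k "n + k"] by auto
        ultimately show ?thesis unfolding E_def by (intro Fn.Diff Fn.Int Fn.finite_UN) auto
      qed
      have [measurable]: "E n \<in> sets M" for n using EF F_sets by blast
      have disj: "disjoint_family E"
      proof -
        have "E m \<inter> E n = {}" if "m < n" for m n
          using that by (auto simp: E_def)
        then show ?thesis unfolding disjoint_family_on_def
          by (metis Int_commute linorder_neqE_nat)
      qed
      have s1: "(\<lambda>n. prob (E n)) sums prob (\<Union>n. E n)"
        by (rule finite_measure_UNION) (auto intro: disj)
      have s2: "(\<lambda>n. 2 * prob (E n - B)) sums (2 * prob (\<Union>n. E n - B))"
        by (intro sums_mult finite_measure_UNION)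
          (use disj in \<open>auto simp: disjoint_family_on_def\<close>)
      have "prob (E n) \<le> 2 * prob (E n - B)" for n
        unfolding B_def by (rule half[OF EF]) (auto simp: E_def N_def)
      then have "prob (\<Union>n. E n) \<le> 2 * prob (\<Union>n. E n - B)" by (rule sums_le[OF _ s1 s2])
      also have "prob (\<Union>n. E n - B) \<le> prob ((B - C) \<union> (C - B))"
        by (rule finite_measure_mono) (auto simp: E_def)
      finally have UE: "prob (\<Union>n. E n) \<le> 2 * (e / 3)" using C(3) by simp
      have "Z \<subseteq> ((B - C) \<union> (C - B)) \<union> (\<Union>n. E n)"
      proof
        fix w assume w: "w \<in> Z"
        show "w \<in> ((B - C) \<union> (C - B)) \<union> (\<Union>n. E n)"
        proof (cases "w \<in> C")
          case True
          have "\<exists>n. w \<in> N (n + k)"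
            using w unfolding Z_def by (force simp: le_iff_add add.commute)
          then have L: "w \<in> N ((LEAST n. w \<in> N (n + k)) + k)" by (rule LeastI_ex)
          have "w \<notin> N j" if "j \<in> {k..<(LEAST n. w \<in> N (n + k)) + k}" for j
            proof -
            have "j - k < (LEAST n. w \<in> N (n + k))" "j - k + k = j" using that by auto
            then show ?thesis using not_less_Least[of "j - k" "\<lambda>n. w \<in> N (n + k)"] by auto
          qed
          then have "w \<in> E (LEAST n. w \<in> N (n + k))" unfolding E_def using L True by blast
          then show ?thesis by blast
        qed (use w in \<open>auto simp: Z_def\<close>)
      qed
      then have "prob Z \<le> prob (((B - C) \<union> (C - B)) \<union> (\<Union>n. E n))"
        by (rule finite_measure_mono) auto
      also have "\<dots> \<le> prob ((B - C) \<union> (C - B)) + prob (\<Union>n. E n)"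
        by (rule measure_Un_le) auto
      also have "\<dots> \<le> 0 + e" using C(3) UE by simp
      finally show ?thesis .
    qed
    then have "prob Z \<le> 0" by (rule field_le_epsilon)
    then have "Z \<in> null_sets M"
      by (auto simp: null_sets_def emeasure_eq_measure measure_le_0_iff)
    then have "AE w in M. w \<notin> Z" by (rule AE_not_in)
    then show ?thesis
    proof (rule AE_mp, intro AE_I2 impI)
      fix w assume w: "w \<in> space M" "w \<notin> Z" "dist (T w) x < r"
      then show "\<forall>\<^sub>F n in sequentially. dist (S n w) x < r"
        by (auto simp: Z_def B_def N_def eventually_sequentially not_le)
    qed
  qed
  obtain D :: "'a set" where D: "countable D" "\<And>X. open X \<Longrightarrow> X \<noteq> {} \<Longrightarrow> \<exists>d\<in>D. d \<in> X"
    by (rule countable_dense_setE) blast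
  have "AE w in M. \<forall>x\<in>D. \<forall>m::nat. dist (T w) x < 1 / Suc m \<longrightarrow>
      (\<forall>\<^sub>F n in sequentially. dist (S n w) x < 1 / Suc m)"
    using ev D(1) by (subst AE_ball_countable) (auto simp: AE_all_countable)
  then show ?thesis
  proof (rule AE_mp, intro AE_I2 impI)
    fix w assume *: "\<forall>x\<in>D. \<forall>m::nat. dist (T w) x < 1 / Suc m \<longrightarrow>
      (\<forall>\<^sub>F n in sequentially. dist (S n w) x < 1 / Suc m)"
    show "(\<lambda>n. S n w) \<longlonglongrightarrow> T w"
    proof (rule tendstoI)
      fix e :: real assume "e > 0"
      then have "e / 2 > 0" by simp
      then obtain m where m: "1 / real (Suc m) < e / 2" using nat_approx_posE by blast
      obtain x where x: "x \<in> D" "dist (T w) x < 1 / Suc m"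
        using D(2)[of "ball (T w) (1 / Suc m)"] by auto
      then have "\<forall>\<^sub>F n in sequentially. dist (S n w) x < 1 / Suc m" using * by blast
      then show "\<forall>\<^sub>F n in sequentially. dist (S n w) (T w) < e"
      proof eventually_elim
        case (elim n)
        have "dist (S n w) (T w) \<le> dist (S n w) x + dist (T w) x" by (rule dist_triangle2)
        then show ?case using elim x(2) m by simp
      qed
    qed
  qed
qed

end

section \<open>Gaussian disintegrations\<close>

lemma std_normal_cos_integral:
  "(\<integral>x. std_normal_density x * cos (s * x + c) \<partial>lborel) = cos c * exp (- s\<^sup>2 / 2)"
proof -
  interpret real_distribution std_normal_distribution by (rule real_dist_normal_dist)
  have "char std_normal_distribution s = Complex (\<integral>x. cos (s * x) \<partial>std_normal_distribution)
      (\<integral>x. cos (s * x - pi / 2) \<partial>std_normal_distribution)"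
    unfolding char_def
    using integral_iexp_eq_cos_sin[of std_normal_distribution "\<lambda>x. s * x"] finite_measure_axioms by simp
  then have C: "(\<integral>x. cos (s * x) \<partial>std_normal_distribution) = exp (- s\<^sup>2 / 2)"
    and S: "(\<integral>x. cos (s * x - pi / 2) \<partial>std_normal_distribution) = 0"
    unfolding char_std_normal_distribution by (auto simp: complex_eq_iff)
  have eq: "(\<integral>x. f x \<partial>std_normal_distribution) = (\<integral>x. std_normal_density x * f x \<partial>lborel)"
    if [measurable]: "f \<in> borel_measurable borel" for f :: "real \<Rightarrow> real"
    by (subst integral_density) (auto simp: normal_density_nonneg)
  have int: "integrable std_normal_distribution (\<lambda>x. cos (s * x))"
    "integrable std_normal_distribution (\<lambda>x. sin (s * x))"
    by (auto intro!: integrable_const_bound[where B=1])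
  have "(\<integral>x. std_normal_density x * cos (s * x + c) \<partial>lborel) = (\<integral>x. cos (s * x + c) \<partial>std_normal_distribution)"
    by (simp add: eq)
  also have "\<dots> = (\<integral>x. cos c * cos (s * x) - sin c * sin (s * x) \<partial>std_normal_distribution)"
    by (simp add: cos_add mult.commute)
  also have "\<dots> = cos c * (\<integral>x. cos (s * x) \<partial>std_normal_distribution) - sin c * (\<integral>x. sin (s * x) \<partial>std_normal_distribution)"
    using int by simp
  also have "(\<integral>x. sin (s * x) \<partial>std_normal_distribution) = 0" using S by (simp add: cos_diff)
  finally show ?thesis using C by simp
qed

lemma gaussian_real_cos_integral:
  assumes "gaussian_real \<nu>"
  shows "(\<integral>x. cos (x + c) \<partial>\<nu>) = cos ((\<integral>x. x \<partial>\<nu>) + c) * exp (- (\<integral>x. (x - (\<integral>x. x \<partial>\<nu>))\<^sup>2 \<partial>\<nu>) / 2)"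
  using assms unfolding gaussian_real_def
proof (elim disjE exE conjE)
  fix m \<sigma> :: real assume \<sigma>: "\<sigma> > 0" and \<nu>: "\<nu> = density lborel (\<lambda>x. ennreal (normal_density m \<sigma> x))"
  have eq: "(\<integral>x. f x \<partial>\<nu>) = (\<integral>x. normal_density m \<sigma> x * f x \<partial>lborel)"
    if [measurable]: "f \<in> borel_measurable borel" for f :: "real \<Rightarrow> real"
    unfolding \<nu> by (subst integral_density) (auto simp: normal_density_nonneg)
  have mean: "(\<integral>x. x \<partial>\<nu>) = m" using integral_normal_moment_nz_1[OF \<sigma>, of m] by (simp add: eq)
  have var: "(\<integral>x. (x - m)\<^sup>2 \<partial>\<nu>) = \<sigma>\<^sup>2"
    using integral_normal_moment_even[OF \<sigma>, of m 1] by (simp add: eq fact_2)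
  have "(\<integral>x. cos (x + c) \<partial>\<nu>) = (\<integral>x. normal_density m \<sigma> x * cos (x + c) \<partial>lborel)"
    by (simp add: eq)
  also have "\<dots> = \<bar>\<sigma>\<bar> *\<^sub>R (\<integral>x. normal_density m \<sigma> (m + \<sigma> * x) * cos (m + \<sigma> * x + c) \<partial>lborel)"
    by (rule lborel_integral_real_affine) (use \<sigma> in simp)
  also have "\<dots> = (\<integral>x. std_normal_density x * cos (\<sigma> * x + (m + c)) \<partial>lborel)"
  proof (subst integral_scaleR_right[symmetric], rule Bochner_Integration.integral_cong[OF refl])
    fix x
    have "\<sigma> * normal_density m \<sigma> (m + \<sigma> * x) = std_normal_density x"
      using \<sigma> by (simp add: normal_density_def real_sqrt_mult power_mult_distrib field_simps)
    then show "\<bar>\<sigma>\<bar> *\<^sub>R (normal_density m \<sigma> (m + \<sigma> * x) * cos (m + \<sigma> * x + c)) =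
        std_normal_density x * cos (\<sigma> * x + (m + c))"
      using \<sigma> by (simp add: ac_simps)
  qed
  also have "\<dots> = cos (m + c) * exp (- \<sigma>\<^sup>2 / 2)" by (rule std_normal_cos_integral)
  finally show ?thesis by (simp add: mean var)
qed (simp add: integral_return)

lemma blinfun_borel_measurable:
  assumes "sets M = sets borel"
  shows "blinfun_apply g \<in> borel_measurable M"
  unfolding measurable_cong_sets[OF assms refl]
  by (intro borel_measurable_continuous_onI continuous_intros)

lemma gaussian_measure_cos_integral:
  fixes K :: "'a::{banach, second_countable_topology} measure"
  assumes K: "gaussian_measure K" and m: "is_mean_element K m" and C: "is_covariance_operator K C"
  shows "(\<integral>f. cos (blinfun_apply g f + c) \<partial>K) =
    cos (blinfun_apply g m + c) * exp (- blinfun_apply g (blinfun_apply C g) / 2)"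
proof -
  have "sets K = sets borel" using K by (simp add: gaussian_measure_def)
  then have [measurable]: "blinfun_apply g \<in> borel_measurable K"
    by (rule blinfun_borel_measurable)
  obtain m' where m': "is_mean_element K m'"
    "blinfun_apply g (blinfun_apply C g) = (\<integral>f. (blinfun_apply g f - blinfun_apply g m') * (blinfun_apply g f - blinfun_apply g m') \<partial>K)"
    using C unfolding is_covariance_operator_def by blast
  have gm: "(\<integral>f. blinfun_apply g f \<partial>K) = blinfun_apply g m" "blinfun_apply g m' = blinfun_apply g m"
    using m m'(1) unfolding is_mean_element_def by metis+
  have eq: "(\<integral>x. h x \<partial>distr K borel (blinfun_apply g)) = (\<integral>f. h (blinfun_apply g f) \<partial>K)"
    if "h \<in> borel_measurable borel" for h :: "real \<Rightarrow> real"
    using that by (subst integral_distr) auto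
  have "gaussian_real (distr K borel (blinfun_apply g))" using K by (simp add: gaussian_measure_def)
  from gaussian_real_cos_integral[OF this, of c] show ?thesis
    by (simp add: eq gm m'(2) power2_eq_square)
qed

lemma covariance_operator_symmetric:
  assumes "is_covariance_operator K C"
  shows "blinfun_apply g (blinfun_apply C h) = blinfun_apply h (blinfun_apply C g)"
proof -
  obtain m where "\<And>g h. blinfun_apply h (blinfun_apply C g) =
      (\<integral>f. (blinfun_apply g f - blinfun_apply g m) * (blinfun_apply h f - blinfun_apply h m) \<partial>K)"
    using assms unfolding is_covariance_operator_def by blast
  then show ?thesis by (simp add: mult.commute)
qed

lemma covariance_operator_degenerate:
  fixes K :: "'a::{banach, second_countable_topology} measure"
  assumes C: "is_covariance_operator K C" and m: "is_mean_element K m"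
    and const: "AE f in K. blinfun_apply h f = a" and a: "blinfun_apply h m = a"
  shows "blinfun_apply C h = 0"
proof (rule dual_separates_points)
  fix g :: "'a \<Rightarrow>\<^sub>L real"
  obtain m' where m': "is_mean_element K m'"
    "blinfun_apply g (blinfun_apply C h) = (\<integral>f. (blinfun_apply h f - blinfun_apply h m') * (blinfun_apply g f - blinfun_apply g m') \<partial>K)"
    using C unfolding is_covariance_operator_def by blast
  have "blinfun_apply h m' = a"
    using m m'(1) a unfolding is_mean_element_def by metis
  then have "AE f in K. (blinfun_apply h f - blinfun_apply h m') * (blinfun_apply g f - blinfun_apply g m') = 0"
    using const by (auto elim: AE_mp)
  then have "blinfun_apply g (blinfun_apply C h) = 0"
    unfolding m'(2) by (rule integral_eq_zero_AE)
  then show "blinfun_apply g (blinfun_apply C h) = blinfun_apply g 0" by simp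
qed

lemma disintegration_kernel:
  assumes "disintegration M G N K"
  shows "K \<in> measurable N (subprob_algebra M)"
proof (rule measurable_subprob_algebra)
  have K: "\<And>y. y \<in> space N \<Longrightarrow> prob_space (K y) \<and> sets (K y) = sets M"
    and meas: "\<And>A. A \<in> sets M \<Longrightarrow> (\<lambda>y. measure (K y) A) \<in> borel_measurable N"
    using assms by (auto simp: disintegration_def)
  show "subprob_space (K y)" "sets (K y) = sets M" if "y \<in> space N" for y
    using K[OF that] by (auto intro: prob_space_imp_subprob_space)
  show "(\<lambda>y. emeasure (K y) A) \<in> borel_measurable N" if "A \<in> sets M" for A
  proof -
    have "(\<lambda>y. ennreal (measure (K y) A)) \<in> borel_measurable N" using meas[OF that] by measurable
    moreover have "emeasure (K y) A = ennreal (measure (K y) A)" if "y \<in> space N" for y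
      using K[OF that] by (simp add: finite_measure.emeasure_eq_measure prob_space.finite_measure)
    ultimately show ?thesis by (simp cong: measurable_cong)
  qed
qed

text \<open>The averaging property of a disintegration says that \<open>M\<close> is the composition of the law of \<open>G\<close> with the
  kernel \<open>K\<close>, from which the formula passes from events to bounded functions.\<close>

lemma disintegration_integral:
  fixes \<psi> :: "'a \<Rightarrow> real"
  assumes dis: "disintegration M G N K" and M: "prob_space M" and G: "G \<in> measurable M N"
    and \<psi>[measurable]: "\<psi> \<in> borel_measurable M" and bnd: "\<And>x. \<bar>\<psi> x\<bar> \<le> B"
  shows "(\<integral>x. \<psi> x \<partial>M) = (\<integral>y. (\<integral>x. \<psi> x \<partial>K y) \<partial>distr M N G)"
proof -
  let ?D = "distr M N G"
  interpret M: prob_space M by fact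
  interpret D: prob_space ?D by (rule M.prob_space_distr[OF G])
  have K: "K \<in> measurable ?D (subprob_algebra M)" using disintegration_kernel[OF dis] by simp
  have prob: "prob_space (K y)" if "y \<in> space N" for y
    using dis that by (auto simp: disintegration_def)
  have ne: "space ?D \<noteq> {}" by (rule D.not_empty)
  have "M = ?D \<bind> K"
  proof (rule measure_eqI)
    fix A assume A: "A \<in> sets M"
    have Am: "(\<lambda>y. measure (K y) A) \<in> borel_measurable N"
      using dis A by (auto simp: disintegration_def)
    have "emeasure (?D \<bind> K) A = (\<integral>\<^sup>+y. emeasure (K y) A \<partial>?D)"
      by (rule emeasure_bind[OF ne K A])
    also have "\<dots> = (\<integral>\<^sup>+y. ennreal (measure (K y) A) \<partial>?D)"
      using prob by (intro nn_integral_cong) (simp add: finite_measure.emeasure_eq_measure prob_space.finite_measure)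
    also have "\<dots> = ennreal (\<integral>y. measure (K y) A \<partial>?D)"
      using Am prob by (intro nn_integral_eq_integral D.integrable_const_bound[where B=1] AE_I2)
        (auto simp: prob_space.prob_le_1)
    also have "\<dots> = emeasure M A" using dis A by (simp add: disintegration_def M.emeasure_eq_measure)
    finally show "emeasure M A = emeasure (?D \<bind> K) A" by simp
  qed (rule sets_bind[OF sets_kernel[OF K] ne, symmetric])
  then have "(\<integral>x. \<psi> x \<partial>M) = (\<integral>x. \<psi> x \<partial>join (distr ?D (subprob_algebra M) K))"
    using bind_nonempty''[OF K ne] by simp
  also have "\<dots> = (\<integral>L. integral\<^sup>L L \<psi> \<partial>distr ?D (subprob_algebra M) K)"
  proof (rule integral_join)
    show "finite_measure (distr ?D (subprob_algebra M) K)" by (rule D.finite_measure_distr[OF K])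
    show "AE L in distr ?D (subprob_algebra M) K. emeasure L (space L) \<le> ennreal 1"
      by (rule AE_I2) (auto simp: space_subprob_algebra subprob_space.emeasure_space_le_1)
  qed (use bnd in auto)
  also have "\<dots> = (\<integral>y. (\<integral>x. \<psi> x \<partial>K y) \<partial>?D)"
    by (rule integral_distr[OF K]) measurable
  finally show ?thesis .
qed

lemma gaussian_disintegration_good:
  fixes \<mu> :: "'a::{banach, second_countable_topology} measure"
    and G :: "'a \<Rightarrow> 'b::{banach, second_countable_topology}"
  assumes dis: "gaussian_disintegration \<mu> G K m C" and \<mu>: "prob_space \<mu>" "sets \<mu> = sets borel"
    and G: "G \<in> borel_measurable borel"
  shows "AE y in distr \<mu> borel G. gaussian_measure (K y) \<and> is_mean_element (K y) (m y) \<and>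
    is_covariance_operator (K y) C \<and> (AE f in K y. G f = y)"
proof -
  interpret prob_space \<mu> by fact
  have Gm: "G \<in> measurable \<mu> borel" using G by (simp only: measurable_cong_sets[OF \<mu>(2) refl])
  interpret D: prob_space "distr \<mu> borel G" by (rule prob_space_distr[OF Gm])
  obtain B where B: "B \<in> sets borel" "measure (distr \<mu> borel G) B = 1"
    "\<And>y. y \<in> B \<Longrightarrow> measure (K y) (G -` {y} \<inter> space \<mu>) = 1"
    and K: "\<And>y. prob_space (K y) \<and> sets (K y) = sets \<mu>"
    using dis by (auto simp: gaussian_disintegration_def disintegration_def)
  have "AE y in distr \<mu> borel G. y \<in> B"
    using D.AE_in_set_eq_1[of B] B by simp
  moreover have "AE f in K y. G f = y" if "y \<in> B" for y
  proof -
    interpret K: prob_space "K y" using K by simp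
    have Gy: "G -` {y} \<inter> space \<mu> \<in> sets (K y)" using measurable_sets[OF Gm, of "{y}"] K by auto
    have "AE f in K y. f \<in> G -` {y} \<inter> space \<mu>"
      using K.AE_in_set_eq_1[OF Gy] B(3)[OF that] by simp
    then show ?thesis by (rule AE_mp) auto
  qed
  ultimately show ?thesis using dis unfolding gaussian_disintegration_def by auto
qed

text \<open>Outside of a null set \<open>g (m y)\<close> is the integral of \<open>g\<close> against a kernel, hence measurable in \<open>y\<close>;
  weak measurability does the rest. The function \<open>m\<close> itself is arbitrary on that null set.\<close>

lemma gaussian_disintegration_mean_measurable:
  fixes \<mu> :: "'a::{banach, second_countable_topology} measure"
    and G :: "'a \<Rightarrow> 'b::{banach, second_countable_topology}"
  assumes dis: "gaussian_disintegration \<mu> G K m C" and \<mu>: "prob_space \<mu>" "sets \<mu> = sets borel"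
    and G: "G \<in> borel_measurable borel"
  obtains m' where "m' \<in> borel_measurable borel" "AE y in distr \<mu> borel G. m y = m' y"
proof -
  have K: "K \<in> measurable borel (subprob_algebra \<mu>)"
    using dis disintegration_kernel by (auto simp: gaussian_disintegration_def)
  obtain N where N: "\<And>y. y \<notin> N \<Longrightarrow> is_mean_element (K y) (m y)" "N \<in> null_sets (distr \<mu> borel G)"
    using gaussian_disintegration_good[OF assms] by (elim AE_E3) auto
  have [measurable]: "N \<in> sets borel" using N(2) by auto
  have "(\<lambda>y. if y \<in> N then 0 else m y) \<in> borel_measurable borel"
  proof (rule borel_measurable_weakly)
    fix g :: "'a \<Rightarrow>\<^sub>L real"
    have [measurable]: "blinfun_apply g \<in> borel_measurable \<mu>"
      by (rule blinfun_borel_measurable[OF \<mu>(2)])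
    have [measurable]: "(\<lambda>y. \<integral>f. blinfun_apply g f \<partial>K y) \<in> borel_measurable borel"
      by (rule measurable_compose[OF K integral_measurable_subprob_algebra]) simp
    have "blinfun_apply g (if y \<in> N then 0 else m y) = (if y \<in> N then 0 else \<integral>f. blinfun_apply g f \<partial>K y)" for y
      using N(1)[of y] by (simp add: is_mean_element_def)
    then show "(\<lambda>y. blinfun_apply g (if y \<in> N then 0 else m y)) \<in> borel_measurable borel"
      by simp
  qed
  moreover have "AE y in distr \<mu> borel G. m y = (if y \<in> N then 0 else m y)"
    using AE_not_in[OF N(2)] by (rule AE_mp) auto
  ultimately show ?thesis using that by blast
qed

text \<open>The conditional characteristic function of \<open>f\<close> given \<open>G f\<close>. A phase \<open>\<theta>\<close> that depends on \<open>G f\<close> may be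
  frozen, as \<open>K y\<close> is concentrated on the fibre over \<open>y\<close>; it records the joint law with \<open>G f\<close>.\<close>

lemma gaussian_disintegration_cos_integral:
  fixes \<mu> :: "'a::{banach, second_countable_topology} measure"
    and G :: "'a \<Rightarrow> 'b::{banach, second_countable_topology}"
  assumes dis: "gaussian_disintegration \<mu> G K m C" and \<mu>: "prob_space \<mu>" "sets \<mu> = sets borel"
    and G: "G \<in> borel_measurable borel"
    and m': "m' \<in> borel_measurable borel" "AE y in distr \<mu> borel G. m y = m' y"
    and \<theta>: "\<theta> \<in> borel_measurable borel"
  shows "(\<integral>f. cos (blinfun_apply g f + \<theta> (G f)) \<partial>\<mu>) =
    (\<integral>y. cos (blinfun_apply g (m' y) + \<theta> y) \<partial>distr \<mu> borel G) * exp (- blinfun_apply g (blinfun_apply C g) / 2)"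
proof -
  have [measurable]: "G \<in> measurable \<mu> borel" "blinfun_apply g \<in> borel_measurable \<mu>"
    using G blinfun_borel_measurable[OF \<mu>(2)] by (simp_all only: measurable_cong_sets[OF \<mu>(2) refl])
  have [measurable]: "blinfun_apply g \<in> borel_measurable borel" by (rule blinfun_borel_measurable) simp
  note [measurable] = m'(1) \<theta>
  have K: "K \<in> measurable borel (subprob_algebra \<mu>)"
    using dis disintegration_kernel by (auto simp: gaussian_disintegration_def)
  have [measurable]: "(\<lambda>y. \<integral>f. cos (blinfun_apply g f + \<theta> (G f)) \<partial>K y) \<in> borel_measurable borel"
    by (rule measurable_compose[OF K integral_measurable_subprob_algebra]) measurable
  have "(\<integral>f. cos (blinfun_apply g f + \<theta> (G f)) \<partial>\<mu>) =
      (\<integral>y. (\<integral>f. cos (blinfun_apply g f + \<theta> (G f)) \<partial>K y) \<partial>distr \<mu> borel G)"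
    by (rule disintegration_integral[where B=1])
      (use dis \<mu> in \<open>auto simp: gaussian_disintegration_def\<close>)
  also have "\<dots> = (\<integral>y. cos (blinfun_apply g (m' y) + \<theta> y) * exp (- blinfun_apply g (blinfun_apply C g) / 2) \<partial>distr \<mu> borel G)"
  proof (rule integral_cong_AE)
    show "AE y in distr \<mu> borel G. (\<integral>f. cos (blinfun_apply g f + \<theta> (G f)) \<partial>K y) =
        cos (blinfun_apply g (m' y) + \<theta> y) * exp (- blinfun_apply g (blinfun_apply C g) / 2)"
      using gaussian_disintegration_good[OF dis \<mu> G] m'(2)
    proof eventually_elim
      case (elim y)
      have sK: "sets (K y) = sets \<mu>" using elim \<mu>(2) by (simp add: gaussian_measure_def)
      have "(\<integral>f. cos (blinfun_apply g f + \<theta> (G f)) \<partial>K y) = (\<integral>f. cos (blinfun_apply g f + \<theta> y) \<partial>K y)"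
        by (rule integral_cong_AE) (use elim in \<open>auto simp: measurable_cong_sets[OF sK refl]\<close>)
      then show ?case
        using gaussian_measure_cos_integral[of "K y" "m y" C g "\<theta> y"] elim by simp
    qed
  qed simp_all
  finally show ?thesis by simp
qed

section \<open>Gaussian vectors independent of a second variable\<close>

lemma scaled_cos_limit: "(\<lambda>n. 2 * (real n)\<^sup>2 * (1 - cos (x / real n))) \<longlonglongrightarrow> x\<^sup>2"
proof -
  have *: "(\<lambda>n. 2 * (real n)\<^sup>2 * (1 - cos (y / real n))) \<longlonglongrightarrow> y\<^sup>2" if "y > 0" for y
    unfolding power2_eq_square[of y] using that by real_asymp
  show ?thesis using *[of x] *[of "- x"] by (cases x "0 :: real" rule: linorder_cases) auto
qed

lemma one_minus_cos_le: "1 - cos x \<le> x\<^sup>2 / (2 :: real)"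
proof -
  have "1 - cos x = 2 * (sin (x / 2))\<^sup>2" using cos_double_sin[of "x / 2"] by simp
  also have "(sin (x / 2))\<^sup>2 \<le> (x / 2)\<^sup>2"
    using abs_sin_x_le_abs_x[of "x / 2"] by (metis abs_le_square_iff)
  finally show ?thesis by (simp add: power_divide)
qed

text \<open>The law \<open>P\<close> of a pair \<open>(Y, T)\<close> in which \<open>T\<close> is independent of \<open>Y\<close> and centred Gaussian with
  covariance operator \<open>D\<close>, together with functionals \<open>e i\<close> that are orthonormal in the
  covariance form of \<open>T\<close>. Both properties of \<open>T\<close> are expressed by \<open>cos_P\<close>.\<close>

locale gaussian_pair = prob_space P
  for P :: "('b::{banach, second_countable_topology} \<times> 'a::{banach, second_countable_topology}) measure" +
  fixes D :: "('a \<Rightarrow>\<^sub>L real) \<Rightarrow>\<^sub>L 'a" and I :: "nat set" and e :: "nat \<Rightarrow> 'a \<Rightarrow>\<^sub>L real"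
  assumes sets_P: "sets P = sets borel"
    and D_sym: "blinfun_apply g (blinfun_apply D h) = blinfun_apply h (blinfun_apply D g)"
    and cos_P: "(\<integral>z. cos (blinfun_apply k (fst z) + blinfun_apply g (snd z) + c) \<partial>P) =
        (\<integral>z. cos (blinfun_apply k (fst z) + c) \<partial>P) * exp (- blinfun_apply g (blinfun_apply D g) / 2)"
    and orthonormal: "i \<in> I \<Longrightarrow> j \<in> I \<Longrightarrow> blinfun_apply (e j) (blinfun_apply D (e i)) = (if i = j then 1 else 0)"
begin

text \<open>\<open>S n T\<close> is the conditional expectation of \<open>T\<close> given the coefficients \<open>e i T\<close> for \<open>i < n\<close> in \<open>I\<close>, the
  functional \<open>res n g\<close> is \<open>g\<close> evaluated at the remainder \<open>T - S n T\<close>, and \<open>q g\<close> is the variance of \<open>g T\<close>.\<close>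

definition u :: "nat \<Rightarrow> 'a" where "u i = blinfun_apply D (e i)"

definition S :: "nat \<Rightarrow> 'a \<Rightarrow> 'a" where "S n t = (\<Sum>i\<in>I \<inter> {..<n}. blinfun_apply (e i) t *\<^sub>R u i)"

definition res :: "nat \<Rightarrow> ('a \<Rightarrow>\<^sub>L real) \<Rightarrow> 'a \<Rightarrow>\<^sub>L real" where
  "res n g = g - (\<Sum>i\<in>I \<inter> {..<n}. blinfun_apply g (u i) *\<^sub>R e i)"

definition q :: "('a \<Rightarrow>\<^sub>L real) \<Rightarrow> real" where "q g = blinfun_apply g (blinfun_apply D g)"

lemmas bl = blinfun.add_left blinfun.diff_left blinfun.scaleR_left blinfun.sum_left blinfun.minus_left
  blinfun.add_right blinfun.diff_right blinfun.scaleR_right blinfun.sum_right blinfun.minus_right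

lemma space_P: "space P = UNIV"
  using sets_eq_imp_space_eq[OF sets_P] by simp

lemma measurable_P: "f \<in> measurable borel N \<Longrightarrow> f \<in> measurable P N"
  by (simp only: measurable_cong_sets[OF sets_P refl])

lemma blinfun_meas[measurable]:
  "blinfun_apply (g :: 'x::{banach, second_countable_topology} \<Rightarrow>\<^sub>L 'y::{banach, second_countable_topology}) \<in> borel_measurable borel"
  by (intro borel_measurable_continuous_onI continuous_intros)

lemma fst_meas[measurable]: "fst \<in> measurable P borel"
  and snd_meas[measurable]: "snd \<in> measurable P borel"
  by (intro measurable_P borel_measurable_continuous_onI continuous_intros)+

lemma S_meas[measurable]: "S n \<in> borel_measurable borel"
  unfolding S_def by measurable

lemma e_u: "i \<in> I \<Longrightarrow> j \<in> I \<Longrightarrow> blinfun_apply (e j) (u i) = (if i = j then 1 else 0)"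
  by (simp add: u_def orthonormal)

lemma e_S: "j \<in> I \<Longrightarrow> j < n \<Longrightarrow> blinfun_apply (e j) (S n t) = blinfun_apply (e j) t"
proof -
  assume j: "j \<in> I" "j < n"
  have "blinfun_apply (e j) (S n t) = (\<Sum>i\<in>I \<inter> {..<n}. blinfun_apply (e i) t * (if i = j then 1 else 0))"
    unfolding S_def bl by (intro sum.cong) (auto simp: e_u j)
  also have "\<dots> = blinfun_apply (e j) t" using j by (simp add: if_distrib[of "\<lambda>x. _ * x"] sum.delta cong: if_cong)
  finally show ?thesis .
qed

lemma res_apply: "blinfun_apply (res n g) t = blinfun_apply g (t - S n t)"
  by (simp add: res_def S_def bl mult.commute)

lemma D_res: "blinfun_apply D (res n g) = blinfun_apply D g - (\<Sum>i\<in>I \<inter> {..<n}. blinfun_apply g (u i) *\<^sub>R u i)"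
  by (simp add: res_def bl u_def)

lemma S_u: "j \<in> I \<Longrightarrow> j < n \<Longrightarrow> S n (u j) = u j"
proof -
  assume j: "j \<in> I" "j < n"
  have "S n (u j) = (\<Sum>i\<in>I \<inter> {..<n}. if i = j then u j else 0)"
    unfolding S_def by (intro sum.cong) (auto simp: e_u j)
  also have "\<dots> = u j" using j by (simp add: sum.delta)
  finally show ?thesis .
qed

lemma e_D_res: "j \<in> I \<Longrightarrow> j < n \<Longrightarrow> blinfun_apply (e j) (blinfun_apply D (res n g)) = 0"
proof -
  assume j: "j \<in> I" "j < n"
  have "blinfun_apply (e j) (blinfun_apply D (res n g)) = blinfun_apply (res n g) (u j)"
    unfolding u_def by (rule D_sym)
  also have "\<dots> = blinfun_apply g (u j - S n (u j))" by (rule res_apply)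
  also have "S n (u j) = u j" by (rule S_u[OF j])
  finally show ?thesis by simp
qed

lemma res_D_res: "blinfun_apply (res n h) (blinfun_apply D (res n g)) = blinfun_apply h (blinfun_apply D (res n g))"
  unfolding res_def[of n h] by (simp add: bl e_D_res)

lemma q_res: "q (res n g) = q g - (\<Sum>i\<in>I \<inter> {..<n}. (blinfun_apply g (u i))\<^sup>2)"
  unfolding q_def res_D_res by (simp add: D_res bl power2_eq_square)

lemma q_scale: "q (s *\<^sub>R g) = s\<^sup>2 * q g"
  by (simp add: q_def bl power2_eq_square)

lemma q_add: "q (g + h) = q g + 2 * blinfun_apply g (blinfun_apply D h) + q h"
  unfolding q_def bl D_sym[of h g] by simp

lemma cos_snd: "(\<integral>z. cos (blinfun_apply g (snd z)) \<partial>P) = exp (- q g / 2)"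
  using cos_P[of 0 g 0] by (simp add: q_def prob_space)

lemma q_nonneg: "q g \<ge> 0"
proof -
  have "exp (- q g / 2) \<le> (\<integral>z. 1 \<partial>P)"
    unfolding cos_snd[symmetric]
    by (intro integral_mono integrable_const_bound[where B=1]) auto
  then show ?thesis by (simp add: prob_space)
qed

lemma D_Cauchy_Schwarz: "(blinfun_apply g (blinfun_apply D h))\<^sup>2 \<le> q g * q h"
proof -
  have *: "0 \<le> q g + 2 * s * blinfun_apply g (blinfun_apply D h) + s\<^sup>2 * q h" for s
    using q_nonneg[of "g + s *\<^sub>R h"] by (simp add: q_add q_scale bl)
  let ?b = "blinfun_apply g (blinfun_apply D h)"
  show ?thesis
  proof (cases "q h = 0")
    case True
    have "?b = 0"
    proof (rule ccontr)
      assume "?b \<noteq> 0"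
      then show False using *[of "- (q g + 1) / (2 * ?b)"] True by (simp add: field_simps)
    qed
    then show ?thesis using True by simp
  next
    case False
    then have pos: "q h > 0" using q_nonneg[of h] by simp
    have "0 \<le> (q g + 2 * (- ?b / q h) * ?b + (- ?b / q h)\<^sup>2 * q h) * q h"
      using *[of "- ?b / q h"] pos by (intro mult_nonneg_nonneg) auto
    also have "\<dots> = q g * q h - ?b\<^sup>2" using pos by (simp add: field_simps power2_eq_square)
    finally show ?thesis by simp
  qed
qed

text \<open>Fatou's lemma for the limit of \<open>2 n\<^sup>2 (1 - cos (x / n))\<close> bounds the second moment by the variance
  parameter in the characteristic function.\<close>

lemma second_moment_le: "(\<integral>\<^sup>+z. ennreal ((blinfun_apply g (snd z))\<^sup>2) \<partial>P) \<le> ennreal (q g)"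
proof -
  let ?v = "\<lambda>n z. ennreal (2 * (real n)\<^sup>2 * (1 - cos (blinfun_apply g (snd z) / real n)))"
  have "(\<integral>\<^sup>+z. ennreal ((blinfun_apply g (snd z))\<^sup>2) \<partial>P) = (\<integral>\<^sup>+z. liminf (\<lambda>n. ?v n z) \<partial>P)"
    by (intro nn_integral_cong lim_imp_Liminf[symmetric] tendsto_ennrealI scaled_cos_limit) simp
  also have "\<dots> \<le> liminf (\<lambda>n. \<integral>\<^sup>+z. ?v n z \<partial>P)"
    by (rule nn_integral_liminf) measurable
  also have "\<dots> \<le> liminf (\<lambda>n::nat. ennreal (q g))"
  proof (intro Liminf_mono always_eventually allI)
    fix n
    have int: "integrable P (\<lambda>z. cos (blinfun_apply g (snd z) / real n))"
      by (rule integrable_const_bound[where B=1]) auto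
    have "(\<integral>\<^sup>+z. ?v n z \<partial>P) = ennreal (\<integral>z. 2 * (real n)\<^sup>2 * (1 - cos (blinfun_apply g (snd z) / real n)) \<partial>P)"
      using int by (intro nn_integral_eq_integral) auto
    also have "(\<integral>z. 2 * (real n)\<^sup>2 * (1 - cos (blinfun_apply g (snd z) / real n)) \<partial>P) =
        2 * (real n)\<^sup>2 * (1 - exp (- q ((1 / real n) *\<^sub>R g) / 2))"
      using int cos_snd[of "(1 / real n) *\<^sub>R g"] by (simp add: bl prob_space)
    also have "\<dots> \<le> 2 * (real n)\<^sup>2 * (q ((1 / real n) *\<^sub>R g) / 2)"
      using exp_ge_add_one_self[of "- q ((1 / real n) *\<^sub>R g) / 2"] by (intro mult_left_mono) auto
    also have "\<dots> \<le> q g"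
      using q_nonneg[of g] by (cases "n = 0") (auto simp: q_scale power_divide)
    finally show "(\<integral>\<^sup>+z. ?v n z \<partial>P) \<le> ennreal (q g)" by (simp add: ennreal_leI)
  qed
  also have "\<dots> = ennreal (q g)" by (simp add: Liminf_const)
  finally show ?thesis .
qed

lemma Chebyshev_snd:
  assumes "d > 0"
  shows "prob {z\<in>space P. d \<le> \<bar>blinfun_apply g (snd z)\<bar>} \<le> q g / d\<^sup>2"
proof -
  have int: "integrable P (\<lambda>z. (blinfun_apply g (snd z))\<^sup>2)"
  proof (rule integrableI_bounded)
    have "(\<integral>\<^sup>+z. ennreal (norm ((blinfun_apply g (snd z))\<^sup>2)) \<partial>P) \<le> ennreal (q g)"
      using second_moment_le[of g] by simp
    then show "(\<integral>\<^sup>+z. ennreal (norm ((blinfun_apply g (snd z))\<^sup>2)) \<partial>P) < \<infinity>"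
      using ennreal_less_top le_less_trans by (metis infinity_ennreal_def)
  qed measurable
  have "(\<integral>z. (blinfun_apply g (snd z))\<^sup>2 \<partial>P) \<le> q g"
    using second_moment_le[of g] nn_integral_eq_integral[OF int] q_nonneg[of g] by simp
  moreover have "prob {z\<in>space P. d\<^sup>2 \<le> (blinfun_apply g (snd z))\<^sup>2} \<le> (\<integral>z. (blinfun_apply g (snd z))\<^sup>2 \<partial>P) / d\<^sup>2"
    by (rule integral_Markov_inequality_measure[where A="{}", OF int]) (use assms in auto)
  moreover have "{z\<in>space P. d\<^sup>2 \<le> (blinfun_apply g (snd z))\<^sup>2} = {z\<in>space P. d \<le> \<bar>blinfun_apply g (snd z)\<bar>}"
    using assms abs_le_square_iff[of d] by auto
  moreover have "(\<integral>z. (blinfun_apply g (snd z))\<^sup>2 \<partial>P) / d\<^sup>2 \<le> q g / d\<^sup>2"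
    by (rule divide_right_mono) (use calculation(1) in auto)
  ultimately show ?thesis by simp
qed

definition reflect :: "nat \<Rightarrow> 'b \<times> 'a \<Rightarrow> 'b \<times> 'a" where
  "reflect n z = (fst z, 2 *\<^sub>R S n (snd z) - snd z)"

lemma reflect_meas[measurable]: "reflect n \<in> measurable P borel"
  unfolding reflect_def borel_prod[symmetric] by measurable

text \<open>Reflecting changes the sign of the component \<open>res n g\<close> of a functional \<open>g\<close>. This component is
  orthogonal to what remains of \<open>g\<close>, so the variance, and with it the characteristic function, is the
  same as before.\<close>

lemma reflection_invariant: "distr P borel (reflect n) = P"
proof (rule measure_eqI_cos)
  show "finite_measure (distr P borel (reflect n))" by (rule finite_measure_distr) measurable
  show "finite_measure P" by (rule finite_measure_axioms)
  fix k :: "('b \<times> 'a) \<Rightarrow>\<^sub>L real" and c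
  have bl1: "bounded_linear (\<lambda>y::'b. (y, 0::'a))" and bl2: "bounded_linear (\<lambda>t::'a. (0::'b, t))"
    by (intro bounded_linear_Pair bounded_linear_ident bounded_linear_zero)+
  define k1 where "k1 = k o\<^sub>L Blinfun (\<lambda>y. (y, 0))"
  define k2 where "k2 = k o\<^sub>L Blinfun (\<lambda>t. (0, t))"
  have k: "blinfun_apply k (y, t) = blinfun_apply k1 y + blinfun_apply k2 t" for y t
    using blinfun.add_right[of k "(y, 0)" "(0, t)"]
    by (simp add: k1_def k2_def bounded_linear_Blinfun_apply[OF bl1] bounded_linear_Blinfun_apply[OF bl2])
  define g where "g = k2 + (- 2) *\<^sub>R res n k2"
  have "q g = q k2"
  proof -
    have "blinfun_apply k2 (blinfun_apply D (res n k2)) = q (res n k2)"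
      by (simp add: q_def res_D_res)
    then show ?thesis unfolding g_def q_add q_scale by (simp add: bl)
  qed
  have "(\<integral>z. cos (blinfun_apply k z + c) \<partial>distr P borel (reflect n)) = (\<integral>z. cos (blinfun_apply k (reflect n z) + c) \<partial>P)"
    by (rule integral_distr) measurable
  also have "\<dots> = (\<integral>z. cos (blinfun_apply k1 (fst z) + blinfun_apply g (snd z) + c) \<partial>P)"
    by (simp add: reflect_def k g_def bl res_apply algebra_simps)
  also have "\<dots> = (\<integral>z. cos (blinfun_apply k1 (fst z) + blinfun_apply k2 (snd z) + c) \<partial>P)"
    using \<open>q g = q k2\<close> unfolding cos_P q_def by simp
  also have "\<dots> = (\<integral>z. cos (blinfun_apply k z + c) \<partial>P)"
    using k[of "fst z" "snd z" for z] by simp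
  finally show "(\<integral>z. cos (blinfun_apply k z + c) \<partial>distr P borel (reflect n)) = (\<integral>z. cos (blinfun_apply k z + c) \<partial>P)" .
qed (simp_all add: sets_P)

text \<open>The events that depend on the first component and on the coefficients \<open>e i\<close> of the second component
  for \<open>i < n\<close> only. All of them are invariant under \<open>reflect n\<close>.\<close>

definition F :: "nat \<Rightarrow> ('b \<times> 'a) set set" where
  "F n = {E \<in> sets borel. \<forall>z\<in>E. \<forall>z'. fst z = fst z' \<and>
     (\<forall>i\<in>I. i < n \<longrightarrow> blinfun_apply (e i) (snd z) = blinfun_apply (e i) (snd z')) \<longrightarrow> z' \<in> E}"

lemma F_I:
  assumes "E \<in> sets borel"
    and "\<And>z z'. z \<in> E \<Longrightarrow> fst z = fst z' \<Longrightarrow>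
      (\<And>i. i \<in> I \<Longrightarrow> i < n \<Longrightarrow> blinfun_apply (e i) (snd z) = blinfun_apply (e i) (snd z')) \<Longrightarrow> z' \<in> E"
  shows "E \<in> F n"
  using assms unfolding F_def by blast

lemma F_D1:
  assumes "E \<in> F n" "z \<in> E" "fst z = fst z'"
    "\<And>i. i \<in> I \<Longrightarrow> i < n \<Longrightarrow> blinfun_apply (e i) (snd z) = blinfun_apply (e i) (snd z')"
  shows "z' \<in> E"
  using assms unfolding F_def by blast

lemma F_D:
  assumes "E \<in> F n" "fst z = fst z'"
    "\<And>i. i \<in> I \<Longrightarrow> i < n \<Longrightarrow> blinfun_apply (e i) (snd z) = blinfun_apply (e i) (snd z')"
  shows "z \<in> E \<longleftrightarrow> z' \<in> E"
  using F_D1[OF assms(1), of z z'] F_D1[OF assms(1), of z' z] assms(2,3) by auto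

lemma F_S:
  assumes "A \<in> sets borel"
  shows "{z. S n (snd z) \<in> A} \<in> F n"
proof (rule F_I)
  have "(\<lambda>z. S n (snd z)) \<in> borel_measurable P" by measurable
  from measurable_sets[OF this assms] show "{z :: 'b \<times> 'a. S n (snd z) \<in> A} \<in> sets borel"
    by (simp add: space_P sets_P vimage_def)
  fix z z' :: "'b \<times> 'a"
  assume z: "z \<in> {z. S n (snd z) \<in> A}"
    "\<And>i. i \<in> I \<Longrightarrow> i < n \<Longrightarrow> blinfun_apply (e i) (snd z) = blinfun_apply (e i) (snd z')"
  have "S n (snd z) = S n (snd z')" unfolding S_def using z(2) by (intro sum.cong) auto
  then show "z' \<in> {z. S n (snd z) \<in> A}" using z(1) by simp
qed

lemma F_is_algebra: "algebra (space P) (F n)"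
  unfolding algebra_iff_Un
proof (intro conjI ballI)
  show "F n \<subseteq> Pow (space P)" by (simp add: space_P)
  show "{} \<in> F n" by (simp add: F_def)
  show "space P - E \<in> F n" if E: "E \<in> F n" for E
  proof (rule F_I)
    show "space P - E \<in> sets borel" using E by (simp add: F_def space_P Compl_eq_Diff_UNIV[symmetric] borel_comp)
    show "z' \<in> space P - E" if "z \<in> space P - E" "fst z = fst z'"
      "\<And>i. i \<in> I \<Longrightarrow> i < n \<Longrightarrow> blinfun_apply (e i) (snd z) = blinfun_apply (e i) (snd z')" for z z'
      using F_D[OF E, of z z'] that by (auto simp: space_P)
  qed
  show "A \<union> B \<in> F n" if A: "A \<in> F n" and B: "B \<in> F n" for A B
  proof (rule F_I)
    show "A \<union> B \<in> sets borel" using A B by (auto simp: F_def)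
    show "z' \<in> A \<union> B" if "z \<in> A \<union> B" "fst z = fst z'"
      "\<And>i. i \<in> I \<Longrightarrow> i < n \<Longrightarrow> blinfun_apply (e i) (snd z) = blinfun_apply (e i) (snd z')" for z z'
      using F_D[OF A, of z z'] F_D[OF B, of z z'] that by auto
  qed
qed

lemma F_increasing:
  assumes "m \<le> n"
  shows "F m \<subseteq> F n"
proof
  fix E assume E: "E \<in> F m"
  show "E \<in> F n"
    by (rule F_I) (use E F_D1[OF E] assms in \<open>auto simp: F_def\<close>)
qed

lemma F_events: "F n \<subseteq> sets P"
  by (auto simp: F_def sets_P)

sublocale filtered_prob_space P F
  by (intro filtered_prob_space.intro filtered_prob_space_axioms.intro prob_space_axioms
    F_is_algebra F_increasing F_events)

lemma F_reflect: "E \<in> F n \<Longrightarrow> reflect n z \<in> E \<longleftrightarrow> z \<in> E"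
  by (rule F_D) (auto simp: reflect_def bl e_S)

text \<open>The assumption \<open>snd_eq\<close> says that \<open>T\<close> is a function of \<open>Y\<close> and \<open>G T\<close>; by \<open>spanning\<close> each
  \<open>h (G T)\<close> is a limit in probability of the observed variables \<open>h (G (S n T))\<close>. Together this makes
  the events that \<open>T\<close> is in a ball approximable.\<close>

theorem partial_sums_converge:
  fixes G :: "'a \<Rightarrow>\<^sub>L 'c::{banach, second_countable_topology}"
  assumes \<tau>[measurable]: "(\<lambda>(y, v). \<tau> y v) \<in> borel_measurable (borel \<Otimes>\<^sub>M borel)"
    and snd_eq: "AE z in P. snd z = \<tau> (fst z) (blinfun_apply G (snd z))"
    and spanning: "\<And>h :: 'c \<Rightarrow>\<^sub>L real. (\<lambda>n. q (res n (h o\<^sub>L G))) \<longlonglongrightarrow> 0"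
  shows "AE z in P. (\<lambda>n. S n (snd z)) \<longlonglongrightarrow> snd z"
proof (rule reflection_symmetric_convergence)
  show "(\<lambda>z. snd z) \<in> borel_measurable P" "\<And>n. (\<lambda>z. S n (snd z)) \<in> borel_measurable P"
    by measurable
  show "{z\<in>space P. r \<le> dist (S n (snd z)) x} \<in> F n" for n x r
    using F_S[of "{t. r \<le> dist t x}" n] by (simp add: space_P)
  fix n E x r assume E: "E \<in> F n"
  let ?A = "E \<inter> {z\<in>space P. dist (snd z) x < r}"
  have [measurable]: "E \<in> sets P" using E F_sets by blast
  have "?A \<in> sets P" by measurable
  then have "prob ?A = measure P (reflect n -` ?A \<inter> space P)"
    using measure_distr[OF reflect_meas, of ?A] by (simp add: reflection_invariant sets_P)
  also have "reflect n -` ?A \<inter> space P = E \<inter> {z\<in>space P. dist (2 *\<^sub>R S n (snd z) - snd z) x < r}"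
    using F_reflect[OF E] by (auto simp: space_P) (simp_all add: reflect_def)
  finally show "prob ?A = prob (E \<inter> {z\<in>space P. dist (2 *\<^sub>R S n (snd z) - snd z) x < r})" .
next
  fix x :: 'a and r :: real
  let ?M = "sigma (space P) (approximable P F)"
  have sM: "sets ?M = approximable P F"
    by (rule sigma_algebra.sets_measure_of_eq[OF sigma_algebra_approximable])
  have spM: "space ?M = UNIV" by (simp add: space_measure_of_conv space_P)
  have fstM[measurable]: "fst \<in> measurable ?M borel"
  proof (rule measurableI)
    fix A :: "'b set" assume A: "A \<in> sets borel"
    have "fst -` A \<in> F 0"
    proof (rule F_I)
      show "(fst -` A :: ('b \<times> 'a) set) \<in> sets borel" using measurable_sets[OF fst_meas A] by (simp add: space_P sets_P)
    qed auto
    then show "fst -` A \<inter> space ?M \<in> sets ?M" using F_approximable by (simp add: sM spM)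
  qed simp
  have GM[measurable]: "(\<lambda>z. blinfun_apply G (snd z)) \<in> borel_measurable ?M"
  proof (rule borel_measurable_weakly, rule approximable_limit_in_probability)
    fix h :: "'c \<Rightarrow>\<^sub>L real"
    show "(\<lambda>z. blinfun_apply h (blinfun_apply G (snd z))) \<in> borel_measurable P" by measurable
    show "{z\<in>space P. blinfun_apply h (blinfun_apply G (S n (snd z))) < a} \<in> F n" for n a
      using F_S[of "{t. blinfun_apply h (blinfun_apply G t) < a}" n] by (simp add: space_P)
    fix d :: real assume d: "d > 0"
    show "(\<lambda>n. prob {z\<in>space P. d \<le> \<bar>blinfun_apply h (blinfun_apply G (snd z)) - blinfun_apply h (blinfun_apply G (S n (snd z)))\<bar>}) \<longlonglongrightarrow> 0"
    proof (rule tendsto_sandwich[where f="\<lambda>_. 0" and h="\<lambda>n. q (res n (h o\<^sub>L G)) / d\<^sup>2"])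
      show "(\<lambda>n. q (res n (h o\<^sub>L G)) / d\<^sup>2) \<longlonglongrightarrow> 0"
        using tendsto_divide[OF spanning[of h] tendsto_const[of "d\<^sup>2"]] d by simp
      show "\<forall>\<^sub>F n in sequentially. prob {z\<in>space P. d \<le> \<bar>blinfun_apply h (blinfun_apply G (snd z)) - blinfun_apply h (blinfun_apply G (S n (snd z)))\<bar>} \<le> q (res n (h o\<^sub>L G)) / d\<^sup>2"
        using Chebyshev_snd[OF d, of "res _ (h o\<^sub>L G)"] by (simp add: res_apply bl)
    qed auto
  qed
  have "(\<lambda>z. (fst z, blinfun_apply G (snd z))) \<in> measurable ?M (borel \<Otimes>\<^sub>M borel)" by (rule measurable_Pair[OF fstM GM])
  from measurable_compose[OF this \<tau>] have \<tau>M: "(\<lambda>z. \<tau> (fst z) (blinfun_apply G (snd z))) \<in> borel_measurable ?M"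
    by simp
  have "{t. dist t x < r} \<in> sets borel" by measurable
  from measurable_sets[OF \<tau>M this] have A: "{z. dist (\<tau> (fst z) (blinfun_apply G (snd z))) x < r} \<in> approximable P F"
    by (simp add: sM spM vimage_def)
  show "{z\<in>space P. dist (snd z) x < r} \<in> approximable P F"
  proof (rule approximable_null_modification[OF A])
    show "AE z in P. z \<in> {z. dist (\<tau> (fst z) (blinfun_apply G (snd z))) x < r} \<longleftrightarrow> z \<in> {z\<in>space P. dist (snd z) x < r}"
      using snd_eq by (rule AE_mp) (auto simp: space_P)
  qed measurable
qed

text \<open>\<open>D\<close> minus the sum of the first rank-one operators is \<open>g \<mapsto> D (res n g)\<close>, and its norm is the supremum
  of the covariances of \<open>g (T - S n T)\<close> and \<open>h (T - S n T)\<close> over unit balls, hence at most the supremum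
  of the variances. A Gaussian variable with values at most \<open>norm (T - S n T)\<close> cannot have a large
  variance if this norm is small with high probability; the characteristic function makes that
  quantitative.\<close>

theorem rank_one_sums:
  assumes conv: "AE z in P. (\<lambda>n. S n (snd z)) \<longlonglongrightarrow> snd z"
  shows "(\<lambda>n. \<Sum>i\<in>I \<inter> {..<n}. rank_one (u i)) \<longlonglongrightarrow> D"
proof -
  define a where "a n = 2 * (\<integral>z. min 1 ((norm (snd z - S n (snd z)))\<^sup>2) \<partial>P)" for n
  have "(\<lambda>n. \<integral>z. min 1 ((norm (snd z - S n (snd z)))\<^sup>2) \<partial>P) \<longlonglongrightarrow> (\<integral>z. 0 \<partial>P)"
  proof (rule integral_dominated_convergence[where w="\<lambda>_. 1"])
    show "AE z in P. (\<lambda>n. min 1 ((norm (snd z - S n (snd z)))\<^sup>2)) \<longlonglongrightarrow> 0"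
      using conv
    proof eventually_elim
      case (elim z)
      have "(\<lambda>n. min 1 ((norm (snd z - S n (snd z)))\<^sup>2)) \<longlonglongrightarrow> min 1 ((norm (snd z - snd z))\<^sup>2)"
        by (intro tendsto_intros elim)
      then show ?case by simp
    qed
  qed auto
  from tendsto_mult_left[OF this, of 2] have a: "a \<longlonglongrightarrow> 0" by (simp add: a_def[abs_def])
  have bound: "1 - exp (- q (res n g) / 2) \<le> a n" if g: "norm g \<le> 1" for g n
  proof -
    have int: "integrable P (\<lambda>z. cos (blinfun_apply (res n g) (snd z)))"
      by (rule integrable_const_bound[where B=1]) auto
    have le: "1 - cos (blinfun_apply (res n g) (snd z)) \<le> 2 * min 1 ((norm (snd z - S n (snd z)))\<^sup>2)" for z
    proof -
      let ?x = "blinfun_apply (res n g) (snd z)"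
      have "\<bar>?x\<bar> \<le> norm g * norm (snd z - S n (snd z))"
        unfolding res_apply using norm_blinfun[of g] by simp
      also have "\<dots> \<le> norm (snd z - S n (snd z))" using mult_right_mono[OF g] by fastforce
      finally have "?x\<^sup>2 \<le> (norm (snd z - S n (snd z)))\<^sup>2" by (metis abs_ge_zero power2_abs power_mono)
      moreover have "1 - cos ?x \<le> ?x\<^sup>2 / 2" by (rule one_minus_cos_le)
      moreover have "1 - cos ?x \<le> 2" using cos_ge_minus_one[of ?x] by linarith
      moreover have "0 \<le> (norm (snd z - S n (snd z)))\<^sup>2" by simp
      ultimately show ?thesis unfolding min_def by (auto split: if_split; linarith)
    qed
    have "1 - exp (- q (res n g) / 2) = (\<integral>z. 1 - cos (blinfun_apply (res n g) (snd z)) \<partial>P)"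
      using int by (simp add: cos_snd prob_space)
    also have "\<dots> \<le> (\<integral>z. 2 * min 1 ((norm (snd z - S n (snd z)))\<^sup>2) \<partial>P)"
      using int le by (intro integral_mono integrable_const_bound[where B=2]) auto
    finally show ?thesis by (simp add: a_def)
  qed
  have q_le: "q (res n g) \<le> 4 * a n" if g: "norm g \<le> 1" and an: "a n \<le> 1 / 2" for g n
  proof -
    let ?x = "q (res n g) / 2"
    have x: "?x \<ge> 0" using q_nonneg by simp
    \<comment> \<open>The elementary bound \<open>1 + x \<le> exp x\<close> turns \<open>1 - exp (- x) \<le> a\<close> into
      \<open>x \<le> a (1 + x)\<close>, and this into \<open>x \<le> 2 a\<close> for \<open>a \<le> 1 / 2\<close>.\<close>
    have "(1 - a n) * (1 + ?x) \<le> exp (- ?x) * exp ?x"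
      using bound[OF g, of n] exp_ge_add_one_self[of ?x] an x by (intro mult_mono) auto
    also have "\<dots> = 1" by (simp add: exp_minus)
    finally have "?x \<le> a n * (1 + ?x)" by (simp add: algebra_simps)
    also have "a n * ?x \<le> 1 / 2 * ?x" using an x by (rule mult_right_mono)
    then have "a n * (1 + ?x) \<le> a n + ?x / 2" by (simp add: algebra_simps)
    finally show ?thesis by simp
  qed
  have norm_le: "norm ((\<Sum>i\<in>I \<inter> {..<n}. rank_one (u i)) - D) \<le> 4 * a n" if an: "a n \<le> 1 / 2" for n
  proof (rule norm_blinfun_bound)
    have a0: "0 \<le> a n" by (simp add: a_def)
    then show "0 \<le> 4 * a n" by simp
    fix g
    have eq: "blinfun_apply ((\<Sum>i\<in>I \<inter> {..<n}. rank_one (u i)) - D) g = - blinfun_apply D (res n g)"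
      by (simp add: D_res bl rank_one.rep_eq)
    have unit: "norm (blinfun_apply D (res n g)) \<le> 4 * a n" if g: "norm g \<le> 1" for g
    proof -
      obtain h :: "'a \<Rightarrow>\<^sub>L real" where h: "norm h \<le> 1" "blinfun_apply h (blinfun_apply D (res n g)) = norm (blinfun_apply D (res n g))"
        using norming_functional_exists by blast
      have "(norm (blinfun_apply D (res n g)))\<^sup>2 = (blinfun_apply (res n h) (blinfun_apply D (res n g)))\<^sup>2"
        by (simp add: res_D_res h)
      also have "\<dots> \<le> q (res n h) * q (res n g)" by (rule D_Cauchy_Schwarz)
      also have "\<dots> \<le> (4 * a n) * (4 * a n)"
        using a0 by (intro mult_mono q_le g h an q_nonneg) auto
      finally have "(norm (blinfun_apply D (res n g)))\<^sup>2 \<le> (4 * a n)\<^sup>2" by (simp add: power2_eq_square)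
      then show ?thesis by (rule power2_le_imp_le) (use a0 in simp)
    qed
    show "norm (blinfun_apply ((\<Sum>i\<in>I \<inter> {..<n}. rank_one (u i)) - D) g) \<le> 4 * a n * norm g"
    proof (cases "g = 0")
      case False
      have "res n ((1 / norm g) *\<^sub>R g) = (1 / norm g) *\<^sub>R res n g"
        by (simp add: res_def bl scaleR_diff_right scaleR_sum_right)
      then have "norm (blinfun_apply D (res n g)) / norm g \<le> 4 * a n"
        using unit[of "(1 / norm g) *\<^sub>R g"] False by (simp add: bl)
      then show ?thesis using False by (simp add: eq field_simps)
    qed simp
  qed
  have "(\<lambda>n. (\<Sum>i\<in>I \<inter> {..<n}. rank_one (u i)) - D) \<longlonglongrightarrow> 0"
  proof (rule Lim_null_comparison)
    have "\<forall>\<^sub>F n in sequentially. a n < 1 / 2" using a by (rule order_tendstoD) simp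
    then show "\<forall>\<^sub>F n in sequentially. norm ((\<Sum>i\<in>I \<inter> {..<n}. rank_one (u i)) - D) \<le> 4 * a n"
      by eventually_elim (simp add: norm_le)
    show "(\<lambda>n. 4 * a n) \<longlonglongrightarrow> 0" using tendsto_mult_left[OF a, of 4] by simp
  qed
  then show ?thesis by (rule LIM_zero_cancel)
qed

end

section \<open>Sequential updating of Gaussian disintegrations\<close>

lemma sums_restrict_iff:
  fixes f :: "nat \<Rightarrow> 'a::{comm_monoid_add, topological_space}"
  shows "(\<lambda>i. if i \<in> I then f i else 0) sums s \<longleftrightarrow> (\<lambda>n. \<Sum>i\<in>I \<inter> {..<n}. f i) \<longlonglongrightarrow> s"
  unfolding sums_def by (simp add: sum.inter_restrict[symmetric] Int_commute)

lemma gaussian_disintegration_good_exists: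
  fixes \<mu> :: "'a::{banach, second_countable_topology} measure"
    and G :: "'a \<Rightarrow> 'b::{banach, second_countable_topology}"
  assumes dis: "gaussian_disintegration \<mu> G K m C" and \<mu>: "prob_space \<mu>" "sets \<mu> = sets borel"
    and G: "G \<in> borel_measurable borel"
  obtains y where "gaussian_measure (K y)" "is_mean_element (K y) (m y)"
    "is_covariance_operator (K y) C" "AE f in K y. G f = y"
proof (rule ccontr)
  assume "\<not> thesis"
  interpret D: prob_space "distr \<mu> borel G"
    by (rule prob_space.prob_space_distr[OF \<mu>(1)]) (use G in \<open>simp only: measurable_cong_sets[OF \<mu>(2) refl]\<close>)
  have "AE y in distr \<mu> borel G. False"
    using gaussian_disintegration_good[OF assms]
    by (rule AE_mp) (use that \<open>\<not> thesis\<close> in auto)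
  then show False by simp
qed

text \<open>A linear map \<open>L\<close> that factors through \<open>G\<close> is constant under each \<open>K y\<close>. So the mean element is
  mapped to that constant, and functionals that factor through \<open>L\<close> are degenerate.\<close>

lemma gaussian_disintegration_mean_in_fibre:
  fixes \<mu> :: "'a::{banach, second_countable_topology} measure"
    and G :: "'a \<Rightarrow> 'b::{banach, second_countable_topology}"
    and L :: "'a \<Rightarrow>\<^sub>L 'c::real_normed_vector" and p :: "'b \<Rightarrow> 'c"
  assumes dis: "gaussian_disintegration \<mu> G K m C" and \<mu>: "prob_space \<mu>" "sets \<mu> = sets borel"
    and G: "G \<in> borel_measurable borel" and p: "\<And>x. p (G x) = blinfun_apply L x"
  shows "AE y in distr \<mu> borel G. blinfun_apply L (m y) = p y"
    and "blinfun_apply C (h o\<^sub>L L) = 0"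
proof -
  have *: "blinfun_apply L (m y) = p y \<and> blinfun_apply C (h o\<^sub>L L) = 0"
    if K: "gaussian_measure (K y)" "is_mean_element (K y) (m y)" "is_covariance_operator (K y) C"
      and fibre: "AE f in K y. G f = y" for y h
  proof -
    have sK: "sets (K y) = sets borel" and "prob_space (K y)"
      using K(1) by (auto simp: gaussian_measure_def)
    then interpret K: prob_space "K y" by simp
    have const: "AE f in K y. blinfun_apply (h o\<^sub>L L) f = blinfun_apply h (p y)" for h
      using fibre by (rule AE_mp) (auto simp: p[symmetric])
    have mean: "blinfun_apply (h o\<^sub>L L) (m y) = blinfun_apply h (p y)" for h :: "'c \<Rightarrow>\<^sub>L real"
    proof -
      have "blinfun_apply (h o\<^sub>L L) (m y) = (\<integral>f. blinfun_apply (h o\<^sub>L L) f \<partial>K y)"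
        using K(2) unfolding is_mean_element_def by metis
      also have "\<dots> = (\<integral>f. blinfun_apply h (p y) \<partial>K y)"
      proof (rule integral_cong_AE)
        show "blinfun_apply (h o\<^sub>L L) \<in> borel_measurable (K y)" by (rule blinfun_borel_measurable[OF sK])
      qed (use const in simp_all)
      finally show ?thesis by (simp add: K.prob_space)
    qed
    have "blinfun_apply L (m y) = p y"
      by (rule dual_separates_points) (use mean in simp)
    then show ?thesis
      using covariance_operator_degenerate[OF K(3,2) const mean] by simp
  qed
  note good = gaussian_disintegration_good[OF dis \<mu> G]
  show "AE y in distr \<mu> borel G. blinfun_apply L (m y) = p y"
    using good by (rule AE_mp) (use * in auto)
  show "blinfun_apply C (h o\<^sub>L L) = 0"
    by (rule gaussian_disintegration_good_exists[OF dis \<mu> G]) (use * in blast)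
qed

lemma gaussian_disintegration_covariance_symmetric:
  fixes \<mu> :: "'a::{banach, second_countable_topology} measure"
    and G :: "'a \<Rightarrow> 'b::{banach, second_countable_topology}"
  assumes dis: "gaussian_disintegration \<mu> G K m C" and \<mu>: "prob_space \<mu>" "sets \<mu> = sets borel"
    and G: "G \<in> borel_measurable borel"
  shows "blinfun_apply g (blinfun_apply C h) = blinfun_apply h (blinfun_apply C g)"
  by (rule gaussian_disintegration_good_exists[OF assms]) (rule covariance_operator_symmetric)

lemma exp_cancel_right:
  fixes a b p r :: real
  assumes "a * exp (- p / 2) = b * exp (- r / 2)"
  shows "a = b * exp (- (r - p) / 2)"
proof -
  have "exp (- r / 2) = exp (- (r - p) / 2) * exp (- p / 2)"
    unfolding exp_add[symmetric] by (simp add: field_simps)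
  then have "a * exp (- p / 2) = b * exp (- (r - p) / 2) * exp (- p / 2)"
    using assms by simp
  then show ?thesis using mult_right_cancel[OF exp_not_eq_zero[of "- p / 2"]] by blast
qed

theorem corollary7:
  fixes \<mu> :: "'a::{banach, second_countable_topology} measure"
    and m\<^sub>\<mu> :: 'a
    and C\<^sub>\<mu> :: "('a \<Rightarrow>\<^sub>L real) \<Rightarrow>\<^sub>L 'a"
    and G1 :: "'a \<Rightarrow>\<^sub>L 'b::{banach, second_countable_topology}"
    and G2 :: "'a \<Rightarrow>\<^sub>L 'c::{banach, second_countable_topology}"
    and K1 :: "'b \<Rightarrow> 'a measure" and m1 :: "'b \<Rightarrow> 'a"
    and C1 :: "('a \<Rightarrow>\<^sub>L real) \<Rightarrow>\<^sub>L 'a"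
    and K12 :: "'b \<times> 'c \<Rightarrow> 'a measure" and m12 :: "'b \<times> 'c \<Rightarrow> 'a"
    and C12 :: "('a \<Rightarrow>\<^sub>L real) \<Rightarrow>\<^sub>L 'a"
    and I :: "nat set" and ys :: "nat \<Rightarrow> 'c \<Rightarrow>\<^sub>L real"
  assumes "gaussian_measure \<mu>"
    and "is_mean_element \<mu> m\<^sub>\<mu>"
    and "is_covariance_operator \<mu> C\<^sub>\<mu>"
    and "gaussian_disintegration \<mu> (blinfun_apply G1) K1 m1 C1"
    and "gaussian_disintegration \<mu> (\<lambda>x. (blinfun_apply G1 x, blinfun_apply G2 x)) K12 m12 C12"
    and "representing (\<lambda>y. blinfun_apply G2 (blinfun_apply C1 (y o\<^sub>L G2))) I ys"
  shows "(AE (y1, y2) in distr \<mu> borel (\<lambda>x. (blinfun_apply G1 x, blinfun_apply G2 x)).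
            \<exists>s. (\<lambda>i. if i \<in> I
                     then blinfun_apply (ys i) (y2 - blinfun_apply G2 (m1 y1)) *\<^sub>R
                          blinfun_apply C1 (ys i o\<^sub>L G2)
                     else 0) sums s \<and>
                m12 (y1, y2) = m1 y1 + s) \<and>
         (\<exists>S. (\<lambda>i. if i \<in> I then rank_one (blinfun_apply C1 (ys i o\<^sub>L G2)) else 0) sums S \<and>
              C12 = C1 - S)"
proof -
  note dis1 = assms(4) and dis12 = assms(5)
  have \<mu>: "prob_space \<mu>" "sets \<mu> = sets borel" using assms(1) by (auto simp: gaussian_measure_def)
  interpret prob_space \<mu> by fact
  define G where "G x = (blinfun_apply G1 x, blinfun_apply G2 x)" for x
  define \<nu> where "\<nu> = distr \<mu> borel G"
  define \<nu>1 where "\<nu>1 = distr \<mu> borel (blinfun_apply G1)"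
  note dis12 = dis12[folded G_def]
  have G1b: "blinfun_apply G1 \<in> borel_measurable borel" and Gb: "G \<in> borel_measurable borel"
    unfolding G_def by (intro borel_measurable_continuous_onI continuous_intros)+
  have [measurable]: "blinfun_apply G1 \<in> borel_measurable \<mu>" "G \<in> borel_measurable \<mu>"
    using G1b Gb by (simp_all only: measurable_cong_sets[OF \<mu>(2) refl])
  interpret \<nu>: prob_space \<nu> unfolding \<nu>_def by (rule prob_space_distr) simp
  have sets_\<nu>[measurable_cong]: "sets \<nu> = sets borel" by (simp add: \<nu>_def)
  have [measurable]: "blinfun_apply L \<in> borel_measurable borel"
    for L :: "'x::{banach, second_countable_topology} \<Rightarrow>\<^sub>L 'y::{banach, second_countable_topology}"
    by (intro borel_measurable_continuous_onI continuous_intros)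
  have fstb[measurable]: "fst \<in> borel_measurable (borel :: ('b \<times> 'c) measure)"
    and sndb[measurable]: "snd \<in> borel_measurable (borel :: ('b \<times> 'c) measure)"
    by (intro borel_measurable_continuous_onI continuous_intros)+
  have [measurable]: "fst \<in> borel_measurable (borel :: ('b \<times> 'a) measure)"
    "snd \<in> borel_measurable (borel :: ('b \<times> 'a) measure)"
    by (intro borel_measurable_continuous_onI continuous_intros)+
  have fst_\<nu>: "fst \<in> measurable \<nu> borel" by measurable
  have \<nu>1: "\<nu>1 = distr \<nu> borel fst"
    unfolding \<nu>_def \<nu>1_def by (subst distr_distr) (auto simp: comp_def G_def)

  \<comment> \<open>The mean elements need not depend measurably on the observation; measurable
    versions carry the probabilistic part of the argument.\<close>
  obtain M1 where M1[measurable]: "M1 \<in> borel_measurable borel" and m1: "AE y in \<nu>1. m1 y = M1 y"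
    using gaussian_disintegration_mean_measurable[OF dis1 \<mu> G1b] unfolding \<nu>1_def by blast
  obtain M12 where M12[measurable]: "M12 \<in> borel_measurable borel" and m12: "AE y in \<nu>. m12 y = M12 y"
    using gaussian_disintegration_mean_measurable[OF dis12 \<mu> Gb] unfolding \<nu>_def by blast
  have m1': "AE y in \<nu>. m1 (fst y) = M1 (fst y)"
    using AE_distrD[OF fst_\<nu> m1[unfolded \<nu>1]] .
  have fibre: "AE y in \<nu>. blinfun_apply G2 (m12 y) = snd y"
    and C12_G2: "\<And>h :: 'c \<Rightarrow>\<^sub>L real. blinfun_apply C12 (h o\<^sub>L G2) = 0"
    unfolding \<nu>_def
    by (rule gaussian_disintegration_mean_in_fibre[OF dis12 \<mu> Gb, where p=snd and L=G2]; simp add: G_def)+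

  define D where "D = C1 - C12"
  \<comment> \<open>The variable \<open>t\<close> is the difference of the conditional means; \<open>\<tau>\<close> recovers
    it from the first observation and its own image under \<open>G2\<close>.\<close>
  define \<tau> where "\<tau> y v = M12 (y, v + blinfun_apply G2 (M1 y)) - M1 y" for y v
  define t where "t y = M12 y - M1 (fst y)" for y
  have t_meas[measurable]: "t \<in> borel_measurable borel" unfolding t_def by measurable
  define P where "P = distr \<nu> borel (\<lambda>y. (fst y, t y))"
  have pair_meas[measurable]: "(\<lambda>y. (fst y, t y)) \<in> measurable \<nu> borel"
    unfolding borel_prod[symmetric] by measurable
  have G2_t: "AE y in \<nu>. blinfun_apply G2 (t y) = snd y - blinfun_apply G2 (M1 (fst y))"
    using fibre m12 by eventually_elim (simp add: t_def blinfun.diff_right)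
  have D_G2: "blinfun_apply D (h o\<^sub>L G2) = blinfun_apply C1 (h o\<^sub>L G2)" for h :: "'c \<Rightarrow>\<^sub>L real"
    by (simp add: D_def blinfun.diff_left C12_G2)

  have cosP: "(\<integral>z. cos (blinfun_apply k (fst z) + blinfun_apply g (snd z) + c) \<partial>P) =
        (\<integral>z. cos (blinfun_apply k (fst z) + c) \<partial>P) * exp (- blinfun_apply g (blinfun_apply D g) / 2)" for k g c
  proof -
    \<comment> \<open>The characteristic function of \<open>f - m1 Y1\<close> is computed twice, by
      conditioning on the first observation and on both.\<close>
    define \<theta> where "\<theta> y = blinfun_apply k y - blinfun_apply g (M1 y) + c" for y
    have [measurable]: "\<theta> \<in> borel_measurable borel" unfolding \<theta>_def by measurable
    have "(\<integral>f. cos (blinfun_apply g f + \<theta> (blinfun_apply G1 f)) \<partial>\<mu>) =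
        (\<integral>y. cos (blinfun_apply k y + c) \<partial>\<nu>1) * exp (- blinfun_apply g (blinfun_apply C1 g) / 2)"
      using gaussian_disintegration_cos_integral[OF dis1 \<mu> G1b M1 m1[unfolded \<nu>1_def], of \<theta> g]
      by (simp add: \<theta>_def \<nu>1_def)
    moreover have "(\<integral>f. cos (blinfun_apply g f + \<theta> (blinfun_apply G1 f)) \<partial>\<mu>) =
        (\<integral>y. cos (blinfun_apply k (fst y) + blinfun_apply g (t y) + c) \<partial>\<nu>) * exp (- blinfun_apply g (blinfun_apply C12 g) / 2)"
      using gaussian_disintegration_cos_integral[OF dis12 \<mu> Gb M12 m12[unfolded \<nu>_def], of "\<lambda>y. \<theta> (fst y)" g]
      by (simp add: \<theta>_def \<nu>_def t_def G_def blinfun.diff_right algebra_simps)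
    moreover have "(\<integral>y. cos (blinfun_apply k y + c) \<partial>\<nu>1) = (\<integral>y. cos (blinfun_apply k (fst y) + c) \<partial>\<nu>)"
      unfolding \<nu>1 by (rule integral_distr) measurable
    ultimately have eq: "(\<integral>y. cos (blinfun_apply k (fst y) + blinfun_apply g (t y) + c) \<partial>\<nu>) =
        (\<integral>y. cos (blinfun_apply k (fst y) + c) \<partial>\<nu>) *
        exp (- (blinfun_apply g (blinfun_apply C1 g) - blinfun_apply g (blinfun_apply C12 g)) / 2)"
      by (intro exp_cancel_right) (simp only:)
    have law: "(\<integral>z. f z \<partial>P) = (\<integral>y. f (fst y, t y) \<partial>\<nu>)" if "f \<in> borel_measurable borel"
      for f :: "'b \<times> 'a \<Rightarrow> real"
      unfolding P_def by (rule integral_distr[OF pair_meas that])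
    have "(\<integral>z. cos (blinfun_apply k (fst z) + blinfun_apply g (snd z) + c) \<partial>P) =
        (\<integral>y. cos (blinfun_apply k (fst y) + blinfun_apply g (t y) + c) \<partial>\<nu>)"
      using law[of "\<lambda>z. cos (blinfun_apply k (fst z) + blinfun_apply g (snd z) + c)"] by simp
    moreover have "(\<integral>z. cos (blinfun_apply k (fst z) + c) \<partial>P) = (\<integral>y. cos (blinfun_apply k (fst y) + c) \<partial>\<nu>)"
      using law[of "\<lambda>z. cos (blinfun_apply k (fst z) + c)"] by simp
    ultimately show ?thesis
      using eq by (simp only: D_def blinfun.diff_left blinfun.diff_right)
  qed

  interpret P: prob_space P unfolding P_def by (rule \<nu>.prob_space_distr) simp
  interpret gaussian_pair P D I "\<lambda>i. ys i o\<^sub>L G2"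
  proof
    show "sets P = sets borel" by (simp add: P_def)
    show "blinfun_apply g (blinfun_apply D h) = blinfun_apply h (blinfun_apply D g)" for g h
      using gaussian_disintegration_covariance_symmetric[OF dis1 \<mu> G1b, of g h]
        gaussian_disintegration_covariance_symmetric[OF dis12 \<mu> Gb, of g h]
      by (simp add: D_def blinfun.diff_left blinfun.diff_right)
    show "blinfun_apply (ys j o\<^sub>L G2) (blinfun_apply D (ys i o\<^sub>L G2)) = (if i = j then 1 else 0)"
      if "i \<in> I" "j \<in> I" for i j
      using assms(6) that by (simp add: representing_def D_G2)
  qed (rule cosP)

  have u: "u i = blinfun_apply C1 (ys i o\<^sub>L G2)" for i by (simp add: u_def D_G2)
  have "AE z in P. (\<lambda>n. S n (snd z)) \<longlonglongrightarrow> snd z"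
  proof (rule partial_sums_converge)
    show "(\<lambda>(y, v). \<tau> y v) \<in> borel_measurable (borel \<Otimes>\<^sub>M borel)"
      unfolding \<tau>_def borel_prod[symmetric] by measurable
    show "AE z in P. snd z = \<tau> (fst z) (blinfun_apply G2 (snd z))"
      unfolding P_def
    proof (subst AE_distr_iff)
      show "AE y in \<nu>. snd (fst y, t y) = \<tau> (fst (fst y, t y)) (blinfun_apply G2 (snd (fst y, t y)))"
        using G2_t by eventually_elim (simp add: \<tau>_def t_def)
    qed (unfold \<tau>_def borel_prod[symmetric], measurable)
    fix h :: "'c \<Rightarrow>\<^sub>L real"
    have "((\<lambda>i. (blinfun_apply h (blinfun_apply G2 (u i)))\<^sup>2) has_sum q (h o\<^sub>L G2)) I"
      using assms(6) by (simp add: representing_def u q_def D_G2)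
    then have "((\<lambda>i. if i \<in> I then (blinfun_apply h (blinfun_apply G2 (u i)))\<^sup>2 else 0) has_sum q (h o\<^sub>L G2)) UNIV"
      by (subst has_sum_cong_neutral[where T=I and g="\<lambda>i. (blinfun_apply h (blinfun_apply G2 (u i)))\<^sup>2"]) auto
    from has_sum_imp_sums[OF this]
    have "(\<lambda>n. \<Sum>i\<in>I \<inter> {..<n}. (blinfun_apply (h o\<^sub>L G2) (u i))\<^sup>2) \<longlonglongrightarrow> q (h o\<^sub>L G2)"
      by (simp add: sums_restrict_iff)
    from tendsto_diff[OF tendsto_const[of "q (h o\<^sub>L G2)"] this]
    show "(\<lambda>n. q (res n (h o\<^sub>L G2))) \<longlonglongrightarrow> 0" by (simp add: q_res)
  qed
  note conv = this

  have "AE y in \<nu>. (\<lambda>n. S n (t y)) \<longlonglongrightarrow> t y"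
    using AE_distrD[OF pair_meas conv[unfolded P_def]] by simp
  then have "AE y in \<nu>. (\<lambda>i. if i \<in> I then blinfun_apply (ys i) (snd y - blinfun_apply G2 (m1 (fst y))) *\<^sub>R
      blinfun_apply C1 (ys i o\<^sub>L G2) else 0) sums (t y) \<and> m12 y = m1 (fst y) + t y"
    using G2_t m1' m12
    by eventually_elim (simp add: sums_restrict_iff S_def u t_def)
  then have "AE (y1, y2) in \<nu>. \<exists>s. (\<lambda>i. if i \<in> I then blinfun_apply (ys i) (y2 - blinfun_apply G2 (m1 y1)) *\<^sub>R
      blinfun_apply C1 (ys i o\<^sub>L G2) else 0) sums s \<and> m12 (y1, y2) = m1 y1 + s"
    unfolding case_prod_beta prod.collapse by (rule AE_mp) (intro AE_I2, blast)
  moreover have "(\<lambda>i. if i \<in> I then rank_one (blinfun_apply C1 (ys i o\<^sub>L G2)) else 0) sums D"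
    using rank_one_sums[OF conv] by (simp add: sums_restrict_iff u)
  moreover have "C12 = C1 - D" by (simp add: D_def)
  ultimately show ?thesis unfolding \<nu>_def G_def by blast
qed

end
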